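(* Let $\mathsf{M}$ be a $d\times d$ real-valued invertible matrix. Let $\Phi$ and $\Psi$ be subsets of $L_2(\mathbb{R}^d)$. Suppose that for some integer $J$ the system $\mathsf{WS}_J(\Phi;\Psi)$ is a nonhomogeneous Riesz $\mathsf{M}$-wavelet basis in $L_2(\mathbb{R}^d)$, that is, its linear span is dense in $L_2(\mathbb{R}^d)$ and there are positive constants $C_3,C_4$ such that $$C_3\Big(\sum_{\phi\in\Phi}\sum_{k\in\mathbb{Z}^d}|v_{k,\phi}|^2+\sum_{j=J}^\infty\sum_{\psi\in\Psi}\sum_{k\in\mathbb{Z}^d}|w_{j;k,\psi}|^2\Big)\le\Big\|\sum_{\phi\in\Phi}\sum_{k\in\mathbb{Z}^d}v_{k,\phi}\phi_{\mathsf{M}^J;k}+\sum_{j=J}^\infty\sum_{\psi\in\Psi}\sum_{k\in\mathbb{Z}^d}w_{j;k,\psi}\psi_{\mathsf{M}^j;k}\Big\|^2_{L_2(\mathbb{R}^d)}$$ $$\le C_4\Big(\sum_{\phi\in\Phi}\sum_{k\in\mathbb{Z}^d}|v_{k,\phi}|^2+\sum_{j=J}^\infty\sum_{\psi\in\Psi}\sum_{k\in\mathbb{Z}^d}|w_{j;k,\psi}|^2\Big)$$ for all finitely supported sequences $\{v_{k,\phi}\}_{k\in\mathbb{Z}^d,\phi\in\Phi}$ and $\{w_{j;k,\psi}\}_{j\ge J,k\in\mathbb{Z}^d,\psi\in\Psi}$. Then these inequalities hold with the same $C_3,C_4$ for all integers $J$, and $\mathsf{WS}_J(\Phi;\Psi)$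 is a nonhomogeneous Riesz $\mathsf{M}$-wavelet basis in $L_2(\mathbb{R}^d)$ with the same lower and upper Riesz bounds for all integers $J$. If $\mathsf{M}$ is a $d\times d$ real-valued expansive matrix and $\sum_{\phi\in\Phi}\|\phi\|^2_{L_2(\mathbb{R}^d)}<\infty$, then $\mathsf{WS}(\Psi)$ is a homogeneous Riesz $\mathsf{M}$-wavelet basis in $L_2(\mathbb{R}^d)$ with the same constants $C_3,C_4$, that is, the linear span of $\mathsf{WS}(\Psi)$ is dense in $L_2(\mathbb{R}^d)$ and $$C_3\sum_{j\in\mathbb{Z}}\sum_{\psi\in\Psi}\sum_{k\in\mathbb{Z}^d}|w_{j;k,\psi}|^2\le\Big\|\sum_{j\in\mathbb{Z}}\sum_{\psi\in\Psi}\sum_{k\in\mathbb{Z}^d}w_{j;k,\psi}\psi_{\mathsf{M}^j;k}\Big\|^2_{L_2(\mathbb{R}^d)}\le C_4\sum_{j\in\mathbb{Z}}\sum_{\psi\in\Psi}\sum_{k\in\mathbb{Z}^d}|w_{j;k,\psi}|^2$$ for all finitely supported sequences $\{w_{j;k,\psi}\}_{j\in\mathbb{Z},k\in\mathbb{Z}^d,\psi\in\Psi}$.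
   Context: For $f:\mathbb{R}^d\to\mathbb{C}$, a $d\times d$ real invertible matrix $U$ and $k\in\mathbb{R}^d$, put $f_{U;k}(x):=|\det U|^{1/2}f(Ux-k)$. For subsets $\Phi,\Psi$ of $L_2(\mathbb{R}^d)$ and $J\in\mathbb{Z}$, $$\mathsf{WS}_J(\Phi;\Psi):=\{\phi_{\mathsf{M}^J;k}: k\in\mathbb{Z}^d,\phi\in\Phi\}\cup\{\psi_{\mathsf{M}^j;k}: j\ge J,\ k\in\mathbb{Z}^d,\psi\in\Psi\},\qquad \mathsf{WS}(\Psi):=\{\psi_{\mathsf{M}^j;k}: j\in\mathbb{Z},k\in\mathbb{Z}^d,\psi\in\Psi\}.$$ The sets $\Phi,\Psi$ may be infinite and their elements are not necessarily distinct; they are counted with multiplicity (systems are indexed families). The best possible constants $C_3$ and $C_4$ for $\mathsf{WS}_J(\Phi;\Psi)$ are called its lower and upper Riesz bounds. A matrix is expansive if all its eigenvalues have modulus greater than one. *)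

theory Defs
  imports "HOL-Analysis.Analysis"
begin

text \<open>Elements of \<open>L\<^sub>2\<close> are represented by functions rather than by classes modulo null sets.
  Every notion below is invariant under changes on Lebesgue null sets.\<close>

definition L2 :: "(real^'d \<Rightarrow> complex) set" where
  "L2 = {f \<in> borel_measurable lebesgue. integrable lebesgue (\<lambda>x. (cmod (f x))\<^sup>2)}"

definition L2norm :: "(real^'d \<Rightarrow> complex) \<Rightarrow> real" where
  "L2norm f = sqrt (\<integral>x. (cmod (f x))\<^sup>2 \<partial>lebesgue)"

text \<open>A family \<open>(e a)\<close>, \<open>a \<in> A\<close>, may list the same function several times; its members are
  then counted with multiplicity. Coefficients outside of \<open>A\<close> are ignored.\<close>

definition supp_on :: "'a set \<Rightarrow> ('a \<Rightarrow> complex) \<Rightarrow> 'a set" where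
  "supp_on A c = {a \<in> A. c a \<noteq> 0}"

definition lin_comb :: "('a \<Rightarrow> real^'d \<Rightarrow> complex) \<Rightarrow> 'a set \<Rightarrow> ('a \<Rightarrow> complex) \<Rightarrow> real^'d \<Rightarrow> complex"
  where "lin_comb e A c x = (\<Sum>a\<in>supp_on A c. c a * e a x)"

definition dense_span :: "('a \<Rightarrow> real^'d \<Rightarrow> complex) \<Rightarrow> 'a set \<Rightarrow> bool" where
  "dense_span e A \<longleftrightarrow>
     (\<forall>f\<in>L2. \<forall>\<epsilon>>0. \<exists>c. finite (supp_on A c) \<and> L2norm (\<lambda>x. f x - lin_comb e A c x) < \<epsilon>)"

definition riesz_lower :: "real \<Rightarrow> ('a \<Rightarrow> real^'d \<Rightarrow> complex) \<Rightarrow> 'a set \<Rightarrow> bool" where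
  "riesz_lower C e A \<longleftrightarrow>
     (\<forall>c. finite (supp_on A c) \<longrightarrow>
        C * (\<Sum>a\<in>supp_on A c. (cmod (c a))\<^sup>2) \<le> (L2norm (lin_comb e A c))\<^sup>2)"

definition riesz_upper :: "real \<Rightarrow> ('a \<Rightarrow> real^'d \<Rightarrow> complex) \<Rightarrow> 'a set \<Rightarrow> bool" where
  "riesz_upper C e A \<longleftrightarrow>
     (\<forall>c. finite (supp_on A c) \<longrightarrow>
        (L2norm (lin_comb e A c))\<^sup>2 \<le> C * (\<Sum>a\<in>supp_on A c. (cmod (c a))\<^sup>2))"

definition riesz_basis_with ::
  "real \<Rightarrow> real \<Rightarrow> ('a \<Rightarrow> real^'d \<Rightarrow> complex) \<Rightarrow> 'a set \<Rightarrow> bool" where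
  "riesz_basis_with C3 C4 e A \<longleftrightarrow>
     (\<forall>a\<in>A. e a \<in> L2) \<and> dense_span e A \<and>
     0 < C3 \<and> 0 < C4 \<and> riesz_lower C3 e A \<and> riesz_upper C4 e A"

definition lower_riesz_bound :: "('a \<Rightarrow> real^'d \<Rightarrow> complex) \<Rightarrow> 'a set \<Rightarrow> real" where
  "lower_riesz_bound e A = Sup {C. 0 < C \<and> riesz_lower C e A}"

definition upper_riesz_bound :: "('a \<Rightarrow> real^'d \<Rightarrow> complex) \<Rightarrow> 'a set \<Rightarrow> real" where
  "upper_riesz_bound e A = Inf {C. 0 < C \<and> riesz_upper C e A}"

text \<open>The library's \<open>M ^ n\<close> on \<open>real^'d^'d\<close> is the entrywise power, so powers with respect to
  the matrix product have to be defined.\<close>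

definition mat_pow :: "real^'d^'d \<Rightarrow> nat \<Rightarrow> real^'d^'d" where
  "mat_pow M n = (((**) M) ^^ n) (mat 1)"

definition mat_powi :: "real^'d^'d \<Rightarrow> int \<Rightarrow> real^'d^'d" where
  "mat_powi M j = (if 0 \<le> j then mat_pow M (nat j) else mat_pow (matrix_inv M) (nat (- j)))"

definition expansive :: "real^'d^'d \<Rightarrow> bool" where
  "expansive M \<longleftrightarrow>
     (\<forall>(z::complex) (v::complex^'d).
        v \<noteq> 0 \<and> map_matrix complex_of_real M *v v = z *s v \<longrightarrow> 1 < cmod z)"

definition int_points :: "(real^'d) set" where
  "int_points = {k. \<forall>i. k $ i \<in> \<int>}"

definition dilate ::
  "real^'d^'d \<Rightarrow> real^'d \<Rightarrow> (real^'d \<Rightarrow> complex) \<Rightarrow> real^'d \<Rightarrow> complex" where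
  "dilate U k f x = complex_of_real (sqrt \<bar>det U\<bar>) * f (U *v x - k)"

text \<open>The generators form families \<open>(\<phi> i)\<close>, \<open>i \<in> I\<close>, and \<open>(\<psi> l)\<close>, \<open>l \<in> L\<close>. The
  nonhomogeneous system is indexed by the disjoint sum of the indices \<open>(i, k)\<close> of the first part
  and \<open>(j, l, k)\<close> of the second, so one coefficient family \<open>c\<close> on it amounts to the pair of
  families \<open>v = c \<circ> Inl\<close>, \<open>w = c \<circ> Inr\<close>.\<close>

definition nonhom_index ::
  "int \<Rightarrow> 'i set \<Rightarrow> 'l set \<Rightarrow> (('i \<times> (real^'d)) + (int \<times> 'l \<times> (real^'d))) set" where
  "nonhom_index J I L = (I \<times> int_points) <+> ({J..} \<times> L \<times> int_points)"

definition hom_system ::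
  "real^'d^'d \<Rightarrow> ('l \<Rightarrow> real^'d \<Rightarrow> complex) \<Rightarrow> int \<times> 'l \<times> (real^'d) \<Rightarrow> real^'d \<Rightarrow> complex" where
  "hom_system M \<psi> = (\<lambda>(j, l, k). dilate (mat_powi M j) k (\<psi> l))"

definition hom_index :: "'l set \<Rightarrow> (int \<times> 'l \<times> (real^'d)) set" where
  "hom_index L = UNIV \<times> L \<times> int_points"

definition nonhom_system ::
  "real^'d^'d \<Rightarrow> int \<Rightarrow> ('i \<Rightarrow> real^'d \<Rightarrow> complex) \<Rightarrow> ('l \<Rightarrow> real^'d \<Rightarrow> complex)
     \<Rightarrow> ('i \<times> (real^'d)) + (int \<times> 'l \<times> (real^'d)) \<Rightarrow> real^'d \<Rightarrow> complex" where
  "nonhom_system M J \<phi> \<psi> =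
     case_sum (\<lambda>(i, k). dilate (mat_powi M J) k (\<phi> i)) (hom_system M \<psi>)"

end

theory Submission
  imports Defs "HOL-Computational_Algebra.Fundamental_Theorem_Algebra"
begin

text \<open>Since \<open>M\<^bsup>j+n\<^esup> = M\<^sup>j M\<^sup>n\<close>, the unitary dilation by \<open>M\<^sup>n\<close> carries the system
with coarsest scale \<open>J\<close> onto the one with coarsest scale \<open>J + n\<close>, merely relabelling the
scales. Riesz inequalities and density of the span therefore do not depend on \<open>J\<close>
(\<open>nonhom_riesz_shift\<close>). A finite linear combination of the homogeneous system involves
finitely many scales, so it already lives in a nonhomogeneous system with \<open>J\<close> low enough,
and inherits the same Riesz inequalities (\<open>hom_riesz_lower\<close>, \<open>hom_riesz_upper\<close>).

What needs an argument is that the homogeneous system is complete (\<open>hom_dense_span\<close>). In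
Hilbert space terms: let \<open>g\<close> be orthogonal to every \<open>\<psi>\<^bsub>j;k\<^esub>\<close>. Approximate \<open>g\<close> by a finite
combination \<open>p = u + w\<close> of the system with coarsest scale \<open>J\<close>, where \<open>u\<close> collects the terms
with \<open>\<phi>\<close> and \<open>w\<close> those with \<open>\<psi>\<close>. Then \<open>\<parallel>g\<parallel>\<^sup>2\<close> is close to \<open>\<langle>g, u\<rangle>\<close>. The coefficients of \<open>u\<close>
are bounded by \<open>\<parallel>p\<parallel> / \<surd>C\<^sub>3\<close>, and on a fixed ball \<open>B\<close> that carries almost all of \<open>g\<close> the mass
of \<open>u\<close> tends to zero as \<open>J\<close> tends to minus infinity: rescaling turns the mass of the
functions \<open>\<phi>\<^bsub>M\<^sup>J;k\<^esub>\<close> on \<open>B\<close> into the mass of the \<open>\<phi>\<close> on the union of the integer translates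
of \<open>M\<^sup>J B\<close>. As \<open>M\<close> is expansive these translates are disjoint and shrink to the integer
lattice, a null set, and the summability of \<open>\<parallel>\<phi>\<parallel>\<^sup>2\<close> makes the convergence uniform over
finite subfamilies (\<open>uniformly_small_mass_near_lattice\<close>, \<open>coarse_part_mass_le\<close>). Hence
\<open>g = 0\<close>.

The argument is carried out with finite sums and without orthogonal projections: \<open>g\<close> is the
error of an almost best approximation from the span, which is almost orthogonal to the span
(\<open>near_best_approximation\<close>).

Two auxiliary facts carry their own proofs. Unitarity of dilations rests on the change of variables
\<open>x \<mapsto> U x - k\<close> for Lebesgue measurable functions over an arbitrary finite index type
(\<open>lebesgue_affine_matrix\<close>). That \<open>M\<^bsup>-n\<^esup>\<close> tends to zero for expansive \<open>M\<close> is proved by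
factoring a polynomial that annihilates a given vector into linear factors
(\<open>powers_tendsto_0_if_annihilated\<close>).\<close>

section \<open>Linear changes of variables for Lebesgue measure\<close>

text \<open>Translating the box so that its lower corner has vanishing \<open>n\<close>-th coordinate reduces the claim
to boxes on which the shear pushes in the nonnegative direction only.\<close>

lemma measure_shear_cbox:
  fixes a b :: "real^'n"
  assumes "m \<noteq> n"
  shows "measure lebesgue ((\<lambda>x. \<chi> i. if i = m then x$m + x$n else x$i) ` cbox a b)
          = measure lebesgue (cbox a b)"
proof (cases "cbox a b = {}")
  case False
  let ?h = "\<lambda>x::real^'n. \<chi> i. if i = m then x$m + x$n else x$i"
  define v :: "real^'n" where "v = - axis n (a $ n)"
  have h: "?h x = ?h (- v) + ?h (v + x)" for x
    by (auto simp: vec_eq_iff)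
  have "?h ` cbox a b = (+) (?h (- v)) ` ?h ` ((+) v ` cbox a b)"
    by (subst image_comp, subst image_comp, rule image_cong[OF refl]) (simp only: o_def h[symmetric])
  then have "measure lebesgue (?h ` cbox a b) = measure lebesgue (?h ` ((+) v ` cbox a b))"
    by (simp only: measure_translation)
  also have "\<dots> = measure lebesgue (?h ` cbox (v + a) (v + b))"
    by (simp only: cbox_translation)
  also have "\<dots> = measure lebesgue (cbox (v + a) (v + b))"
  proof (rule measure_shear_interval[OF assms])
    show "cbox (v + a) (v + b) \<noteq> {}"
      using False cbox_translation[of v a b] by simp
    show "0 \<le> (v + a) $ n" by (simp add: v_def axis_def)
  qed
  also have "\<dots> = measure lebesgue (cbox a b)"
    using measure_translation[of v "cbox a b"] by (simp only: cbox_translation)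
  finally show ?thesis .
qed auto

text \<open>Both sides are multiplicative in \<open>A\<close>, so it suffices to treat elementary matrices. Their
determinants come from row operations and permutations of columns.\<close>

lemma matrix_image_measure:
  fixes A :: "real^'n^'n"
  assumes "S \<in> lmeasurable"
  shows "(*v) A ` S \<in> lmeasurable \<and> measure lebesgue ((*v) A ` S) = \<bar>det A\<bar> * measure lebesgue S"
proof -
  let ?P = "\<lambda>A :: real^'n^'n. \<forall>S\<in>lmeasurable. (*v) A ` S \<in> lmeasurable \<and>
     measure lebesgue ((*v) A ` S) = \<bar>det A\<bar> * measure lebesgue S"
  have suff: "?P A" if "\<And>a b. measure lebesgue ((*v) A ` cbox a b) = \<bar>det A\<bar> * measure lebesgue (cbox a b)"
    for A :: "real^'n^'n"
    using measure_linear_sufficient[OF matrix_vector_mul_linear _ that] by metis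
  have "?P A"
  proof (induction A rule: induct_matrix_elementary_alt[case_names mult zero_row diagonal swap1 idplus])
    case (mult A B)
    have "(*v) (A ** B) ` S = (*v) A ` (*v) B ` S" for S
      by (simp add: image_image matrix_vector_mul_assoc)
    then show ?case using mult by (auto simp: det_mul abs_mult)
  next
    case (zero_row A i)
    have d: "det A = 0" using zero_row det_row_0 row_def
      by (metis vec_lambda_eta det_zero_row(1))
    have "(*v) A ` S \<subseteq> {x. x $ i = 0}" for S
      using zero_row by (auto simp: matrix_vector_mult_def row_def vec_eq_iff)
    then have "negligible ((*v) A ` S)" for S
      using negligible_standard_hyperplane_cart negligible_subset by metis
    then show ?case by (simp add: d negligible_imp_measurable negligible_imp_measure0)
  next
    case (diagonal A)
    have "(\<Sum>j\<in>UNIV. A $ i $ j * x $ j) = A $ i $ i * x $ i" for x i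
      by (subst sum.remove[of _ i]) (use diagonal in \<open>auto intro!: sum.neutral\<close>)
    then have "(*v) A = (\<lambda>x. \<chi> i. A $ i $ i * x $ i)"
      by (auto simp: matrix_vector_mult_def)
    then show ?case
      by (simp add: measurable_stretch measure_stretch det_diagonal[OF diagonal])
  next
    case (swap1 m n)
    let ?t = "Transposition.transpose m n"
    let ?B = "(\<chi> i j. mat 1 $ i $ ?t j) :: real^'n^'n"
    have "\<bar>det ?B\<bar> = 1"
      using swap1 by (subst det_permute_columns) (auto simp: permutes_swap_id sign_swap_id)
    moreover have "measure lebesgue ((*v) ?B ` cbox a b) = measure lebesgue (cbox a b)" for a b
    proof -
      have B: "?B *v x = (\<chi> i. x $ ?t i)" for x
      proof -
        have t: "i = ?t j \<longleftrightarrow> j = ?t i" for i j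
          by (metis transpose_involutory)
        have "(?B *v x) $ i = (\<Sum>j\<in>UNIV. (if i = ?t j then 1 else 0) * x $ j)" for i
          by (simp only: matrix_vector_mult_def mat_def vec_lambda_beta)
        also have "\<dots> i = (\<Sum>j\<in>UNIV. if j = ?t i then x $ j else 0)" for i
          by (rule sum.cong[OF refl]) (subst t, simp)
        finally show ?thesis
          unfolding vec_eq_iff vec_lambda_beta by simp
      qed
      have "(*v) ?B ` cbox a b = cbox (?B *v a) (?B *v b)"
      proof (intro equalityI subsetI)
        fix y assume y: "y \<in> cbox (?B *v a) (?B *v b)"
        have "y = ?B *v (?B *v y)" unfolding B by (simp add: vec_eq_iff)
        moreover have "?B *v y \<in> cbox a b"
        unfolding B mem_box_cart vec_lambda_beta
        proof
          fix i
          show "a $ i \<le> y $ ?t i \<and> y $ ?t i \<le> b $ i"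
            using y[unfolded B mem_box_cart, rule_format, of "?t i"] by simp
        qed
        ultimately show "y \<in> (*v) ?B ` cbox a b" by blast
      qed (auto simp: B mem_box_cart)
      moreover have "measure lborel (cbox (?B *v a) (?B *v b)) = measure lborel (cbox a b)"
      proof -
        have pp: "?t permutes UNIV" by (simp add: permutes_swap_id)
        have ne: "cbox (?B *v a) (?B *v b) = {} \<longleftrightarrow> cbox a b = {}"
          unfolding interval_eq_empty_cart B vec_lambda_beta by (metis transpose_involutory)
        show ?thesis
          unfolding content_cbox_if_cart ne
          using prod.permute[OF pp, of "\<lambda>i. b $ i - a $ i"] by (simp add: B o_def)
      qed
      ultimately show ?thesis by simp
    qed
    ultimately show ?case by (intro suff) simp
  next
    case (idplus m n)
    let ?B = "(\<chi> i j. of_bool (i = m \<and> j = n \<or> i = j)) :: real^'n^'n"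
    have "?B = (\<chi> k. if k = m then row m (mat 1) + 1 *s row n (mat 1) else row k (mat 1))"
      using idplus by (auto simp: vec_eq_iff row_def mat_def)
    then have "det ?B = 1"
      using det_row_operation[OF idplus, of "mat 1" 1] by simp
    moreover have "(*v) ?B = (\<lambda>x. \<chi> i. if i = m then x$m + x$n else x$i)"
    proof
      fix x :: "real^'n"
      have "(\<Sum>j\<in>UNIV. of_bool (j = n \<or> m = j) * x $ j) = x $ m + x $ n"
        by (subst sum.mono_neutral_right[of _ "{m, n}"]) (use idplus in auto)
      moreover have "(\<Sum>j\<in>UNIV. of_bool (i = m \<and> j = n \<or> i = j) * x $ j) = x $ i" if "i \<noteq> m" for i
        by (subst sum.mono_neutral_right[of _ "{i}"]) (use that in auto)
      ultimately show "?B *v x = (\<chi> i. if i = m then x$m + x$n else x$i)"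
        by (auto simp: matrix_vector_mult_def)
    qed
    ultimately show ?case
      using measure_shear_cbox[OF idplus] by (intro suff) simp
  qed
  with assms show ?thesis by blast
qed

lemma invertible_matrix_inv:
  assumes "invertible U"
  shows "U ** matrix_inv U = mat 1" "matrix_inv U ** U = mat 1"
  using someI_ex[OF assms[unfolded invertible_def]] by (simp_all add: matrix_inv_def)

lemma invertible_mult_inv_vec:
  fixes U :: "real^'n^'n"
  assumes "invertible U"
  shows "U *v (matrix_inv U *v x) = x" "matrix_inv U *v (U *v x) = x"
  by (simp_all add: matrix_vector_mul_assoc invertible_matrix_inv[OF assms])

text \<open>Preimages of boxes are images of translated boxes under the inverse matrix, so their volume is
known, and the values on boxes determine the measure.\<close>

lemma lborel_affine_matrix:
  fixes U :: "real^'n^'n"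
  assumes "invertible U"
  shows "lborel = density (distr lborel borel (\<lambda>x. U *v x - k)) (\<lambda>_. \<bar>det U\<bar>)"
proof (rule lborel_eqI)
  let ?T = "\<lambda>x. U *v x - k"
  have [measurable]: "?T \<in> borel_measurable borel"
    by (intro borel_measurable_continuous_onI continuous_intros matrix_vector_mult_linear_continuous_on)
  fix l u :: "real^'n" assume lu: "\<And>b. b \<in> Basis \<Longrightarrow> l \<bullet> b \<le> u \<bullet> b"
  have "?T -` box l u = (*v) (matrix_inv U) ` ((+) k ` box l u)"
    apply (auto simp: image_iff)
    subgoal for x by (intro bexI[of _ "U *v x - k"]) (auto simp: invertible_mult_inv_vec[OF assms])
    subgoal by (simp add: invertible_mult_inv_vec[OF assms])
    done
  moreover have "(+) k ` box l u \<in> lmeasurable"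
    by (intro measurable_translation) simp
  ultimately have m: "?T -` box l u \<in> lmeasurable"
      "measure lebesgue (?T -` box l u) = \<bar>det (matrix_inv U)\<bar> * measure lebesgue (box l u)"
    using matrix_image_measure[of "(+) k ` box l u" "matrix_inv U"]
    by (auto simp: measure_translation)
  have bor: "?T -` box l u \<in> sets borel"
    using measurable_sets_borel[of ?T borel "box l u"] by simp
  have d: "det U * det (matrix_inv U) = 1"
    by (metis assms det_I det_mul invertible_matrix_inv(1))
  have "emeasure lborel (?T -` box l u) = ennreal (measure lebesgue (?T -` box l u))"
    using emeasure_eq_measure2[OF m(1)] bor by simp
  then have "ennreal \<bar>det U\<bar> * emeasure lborel (?T -` box l u)
     = ennreal (\<bar>det U\<bar> * (\<bar>det (matrix_inv U)\<bar> * measure lebesgue (box l u)))"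
    by (simp add: m(2) ennreal_mult)
  also have "\<bar>det U\<bar> * (\<bar>det (matrix_inv U)\<bar> * measure lebesgue (box l u)) = measure lebesgue (box l u)"
    using d by (simp add: flip: mult.assoc abs_mult)
  also have "\<dots> = (\<Prod>b\<in>Basis. (u - l) \<bullet> b)"
    using lu by (simp add: measure_lborel_box_eq)
  finally show "emeasure (density (distr lborel borel ?T) (\<lambda>_. \<bar>det U\<bar>)) (box l u) = (\<Prod>b\<in>Basis. (u - l) \<bullet> b)"
    by (simp add: emeasure_density nn_integral_cmult_indicator emeasure_distr)
qed simp

text \<open>The completion adds null sets only, and the affine map and its inverse preserve Borel null sets.\<close>

lemma lebesgue_affine_matrix:
  fixes U :: "real^'n^'n"
  assumes "invertible U"
  shows "lebesgue = density (distr lebesgue lebesgue (\<lambda>x. U *v x - k)) (\<lambda>_. \<bar>det U\<bar>)"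
    and measurable_affine_matrix: "(\<lambda>x. U *v x - k) \<in> lebesgue \<rightarrow>\<^sub>M lebesgue"
proof -
  let ?T = "\<lambda>x. U *v x - k"
  have [measurable]: "?T \<in> borel_measurable borel"
    by (intro borel_measurable_continuous_onI continuous_intros matrix_vector_mult_linear_continuous_on)
  have d: "det U \<noteq> 0" using assms invertible_det_nz by blast
  { fix A :: "(real^'n) set" assume A: "A \<in> sets borel"
    have "emeasure lborel A = 0 \<longleftrightarrow> emeasure (density (distr lborel borel ?T) (\<lambda>_. \<bar>det U\<bar>)) A = 0"
      using lborel_affine_matrix[OF assms, of k] by simp
    also have "\<dots> \<longleftrightarrow> emeasure (distr lebesgue lborel ?T) A = 0"
      using A d by (simp add: distr_completion emeasure_density nn_integral_cmult cong: distr_cong)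
    finally have "emeasure lborel A = 0 \<longleftrightarrow> emeasure (distr lebesgue lborel ?T) A = 0" . }
  then have eq: "null_sets lborel = null_sets (distr lebesgue lborel ?T)"
    by (auto simp: null_sets_def)
  show "?T \<in> lebesgue \<rightarrow>\<^sub>M lebesgue"
    by (simp add: completion.measurable_completion2 eq measurable_completion)
  have "lebesgue = completion (density (distr lborel borel ?T) (\<lambda>_. \<bar>det U\<bar>))"
    using lborel_affine_matrix[OF assms, of k] by simp
  also have "\<dots> = density (completion (distr lebesgue lborel ?T)) (\<lambda>_. \<bar>det U\<bar>)"
    using d by (auto intro!: completion_density_eq simp: distr_completion cong: distr_cong)
  also have "\<dots> = density (distr lebesgue lebesgue ?T) (\<lambda>_. \<bar>det U\<bar>)"
    by (subst completion.completion_distr_eq) (auto simp: eq measurable_completion)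
  finally show "lebesgue = density (distr lebesgue lebesgue ?T) (\<lambda>_. \<bar>det U\<bar>)" .
qed

lemma integral_affine_matrix:
  fixes U :: "real^'n^'n" and F :: "real^'n \<Rightarrow> real"
  assumes "invertible U" and F[measurable]: "F \<in> borel_measurable lebesgue"
  shows "integrable lebesgue (\<lambda>x. \<bar>det U\<bar> * F (U *v x - k)) \<longleftrightarrow> integrable lebesgue F"
    and "(\<integral>x. \<bar>det U\<bar> * F (U *v x - k) \<partial>lebesgue) = (\<integral>x. F x \<partial>lebesgue)"
proof -
  note [measurable] = measurable_affine_matrix[OF assms(1), of k]
  show "integrable lebesgue (\<lambda>x. \<bar>det U\<bar> * F (U *v x - k)) \<longleftrightarrow> integrable lebesgue F"
    apply (subst (2) lebesgue_affine_matrix[OF assms(1), of k])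
    apply (subst integrable_density, simp, simp, simp)
    apply (subst integrable_distr_eq)
    apply auto
    done
  show "(\<integral>x. \<bar>det U\<bar> * F (U *v x - k) \<partial>lebesgue) = (\<integral>x. F x \<partial>lebesgue)"
    apply (subst (2) lebesgue_affine_matrix[OF assms(1), of k])
    apply (subst integral_density, simp, simp, simp)
    apply (subst integral_distr)
    apply auto
    done
qed

section \<open>Powers of the inverse of an expansive matrix\<close>

text \<open>The vector \<open>p(A) x\<close>, evaluated by Horner's scheme; acting on vectors avoids a ring of matrices.\<close>

definition poly_act :: "complex^'n^'n \<Rightarrow> complex poly \<Rightarrow> complex^'n \<Rightarrow> complex^'n" where
  "poly_act A p x = fold_coeffs (\<lambda>a v. a *s x + A *v v) p 0"

lemma poly_act_0 [simp]: "poly_act A 0 x = 0"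
  by (simp add: poly_act_def)

lemma poly_act_pCons [simp]: "poly_act A (pCons a p) x = a *s x + A *v poly_act A p x"
  by (cases "a = 0 \<and> p = 0") (auto simp: poly_act_def)

lemma poly_act_add: "poly_act A (p + q) x = poly_act A p x + poly_act A q x"
  by (induction p q rule: poly_induct2)
    (auto simp: matrix_vector_right_distrib vector_sadd_rdistrib)

lemma poly_act_sum: "poly_act A (\<Sum>i\<in>S. f i) x = (\<Sum>i\<in>S. poly_act A (f i) x)"
  by (induction S rule: infinite_finite_induct) (auto simp: poly_act_add)

lemma poly_act_smult: "poly_act A (smult c p) x = c *s poly_act A p x"
  by (induction p) (auto simp: matrix_vector_mult_scaleR vector_add_ldistrib vec.scale vector_smult_assoc)

lemma poly_act_monom: "poly_act A (monom c i) x = c *s (((*v) A) ^^ i) x"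
  by (induction i) (auto simp: monom_0 monom_Suc vec.scale)

lemma poly_act_commute: "A *v poly_act A p x = poly_act A p (A *v x)"
  by (induction p) (auto simp: matrix_vector_right_distrib vec.scale)

lemma poly_act_diff_arg: "poly_act A p (x - y) = poly_act A p x - poly_act A p y"
  by (induction p) (auto simp: vec.diff vector_ssub_ldistrib)

lemma poly_act_scale_arg: "poly_act A p (c *s x) = c *s poly_act A p x"
  by (induction p) (auto simp: vec.scale vector_add_ldistrib vector_smult_assoc mult.commute)

lemma poly_act_linear_factor:
  "poly_act A ([:- z, 1:] * q) x = A *v poly_act A q x - z *s poly_act A q x"
proof -
  have "[:- z, 1:] * q = smult (- z) q + pCons 0 q"
    by (simp add: mult_pCons_left)
  then show ?thesis
    by (simp only: poly_act_add poly_act_smult poly_act_pCons) (simp add: vec_eq_iff)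
qed

text \<open>Families rather than sets are needed here, because the members of a Krylov sequence may coincide;
a repetition is itself a linear dependence.\<close>

lemma linear_dependence_family:
  fixes f :: "nat \<Rightarrow> 'a::field^'n"
  assumes "CARD('n) \<le> m"
  obtains u where "\<exists>i\<le>m. u i \<noteq> 0" "(\<Sum>i\<le>m. u i *s f i) = 0"
proof (cases "inj_on f {..m}")
  case True
  have "vec.dependent (f ` {..m})"
  proof (rule ccontr)
    assume "\<not> vec.dependent (f ` {..m})"
    then have "card (f ` {..m}) \<le> vec.dim (UNIV :: ('a^'n) set)"
      by (intro vec.independent_card_le_dim) auto
    then show False
      using assms vec_dim_card[where 'a='a and 'n='n] by (simp add: card_image[OF True] del: vec.dim_UNIV)
  qed
  then obtain w where w: "\<exists>v\<in>f ` {..m}. w v \<noteq> 0" "(\<Sum>v\<in>f ` {..m}. w v *s v) = 0"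
    by (subst (asm) vec.dependent_finite) auto
  show ?thesis
    by (rule that[of "w \<circ> f"]) (use w True in \<open>auto simp: sum.reindex\<close>)
next
  case False
  then obtain i j where ij: "i \<le> m" "j \<le> m" "i \<noteq> j" "f i = f j"
    by (auto simp: inj_on_def)
  let ?u = "\<lambda>k. if k = i then 1 else if k = j then - 1 else 0 :: 'a"
  have "(\<Sum>k\<le>m. ?u k *s f k) = (\<Sum>k\<in>{i, j}. ?u k *s f k)"
    by (rule sum.mono_neutral_right) (use ij in auto)
  also have "\<dots> = 0" using ij by (simp add: vec_eq_iff)
  finally show ?thesis
    by (intro that[of ?u]) (use ij in auto)
qed

text \<open>The vectors \<open>x, A x, A\<^sup>2 x, \<dots>\<close> are linearly dependent.\<close>

lemma annihilating_poly:
  fixes A :: "complex^'n^'n"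
  obtains p where "p \<noteq> 0" "poly_act A p x = 0"
proof -
  obtain u where u: "\<exists>i\<le>CARD('n). u i \<noteq> 0" "(\<Sum>i\<le>CARD('n). u i *s (((*v) A) ^^ i) x) = 0"
    using linear_dependence_family[of "CARD('n)" "\<lambda>i. (((*v) A) ^^ i) x"] by auto
  let ?p = "\<Sum>i\<le>CARD('n). monom (u i) i"
  have "coeff ?p i = u i" if "i \<le> CARD('n)" for i
    using that by (simp add: coeff_sum)
  then have "?p \<noteq> 0" using u(1) by (metis coeff_0)
  moreover have "poly_act A ?p x = 0"
    using u(2) by (simp add: poly_act_sum poly_act_monom)
  ultimately show ?thesis using that by blast
qed

lemma contraction_limit:
  fixes a b :: "nat \<Rightarrow> real"
  assumes step: "\<And>n. a (Suc n) \<le> r * a n + b n" and nn: "\<And>n. 0 \<le> a n"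
    and r: "0 \<le> r" "r < 1" and b: "b \<longlonglongrightarrow> 0"
  shows "a \<longlonglongrightarrow> 0"
proof (rule LIMSEQ_I)
  fix e :: real assume e: "0 < e"
  have "\<forall>\<^sub>F n in sequentially. b n < e / 2 * (1 - r)"
    using b by (rule order_tendstoD(2)) (use e r in simp)
  then obtain N where N: "\<And>n. N \<le> n \<Longrightarrow> b n \<le> e / 2 * (1 - r)"
    unfolding eventually_sequentially using less_imp_le by metis
  have ind: "a (k + N) \<le> r ^ k * a N + e / 2" for k
  proof (induction k)
    case (Suc k)
    have "a (Suc k + N) \<le> r * a (k + N) + b (k + N)" using step by simp
    also have "\<dots> \<le> r * (r ^ k * a N + e / 2) + e / 2 * (1 - r)"
      using Suc.IH r N[of "k + N"] by (intro add_mono mult_left_mono) auto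
    finally show ?case by (simp add: field_simps)
  qed (use e in simp)
  have "(\<lambda>k. r ^ k * a N) \<longlonglongrightarrow> 0"
    using r by (intro tendsto_mult_left_zero LIMSEQ_realpow_zero) auto
  then have "\<forall>\<^sub>F k in sequentially. r ^ k * a N < e / 2"
    by (rule order_tendstoD(2)) (use e in simp)
  then obtain K where K: "\<And>k. K \<le> k \<Longrightarrow> r ^ k * a N < e / 2"
    unfolding eventually_sequentially by blast
  have "norm (a n - 0) < e" if "K + N \<le> n" for n
  proof -
    have "K \<le> n - N" "n - N + N = n" using that by auto
    with ind[of "n - N"] K[of "n - N"] nn[of n] show ?thesis by simp
  qed
  then show "\<exists>n0. \<forall>n\<ge>n0. norm (a n - 0) < e" by blast
qed

lemma norm_complex_scale: "norm (z *s x) = cmod z * norm (x :: complex^'n)"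
proof -
  have "L2_set (\<lambda>i. cmod z * cmod (x $ i)) UNIV = cmod z * L2_set (\<lambda>i. cmod (x $ i)) UNIV"
    by (rule L2_set_right_distrib[symmetric]) simp
  then show ?thesis by (simp add: norm_vec_def norm_mult)
qed

text \<open>Let \<open>z\<close> be a root of \<open>p = (X - z) q\<close>. If \<open>z\<close> lies in the open unit disc, then \<open>q\<close> annihilates
\<open>y = A x - z x\<close>, so \<open>A\<^sup>n y\<close> tends to zero by induction, and \<open>A\<^bsup>n+1\<^esup> x = z A\<^sup>n x + A\<^sup>n y\<close> is a
contraction with a vanishing perturbation. Otherwise \<open>z\<close> is no eigenvalue, so \<open>A - z\<close> is
injective and \<open>q\<close> alone annihilates \<open>x\<close>.\<close>

lemma powers_tendsto_0_if_annihilated: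
  fixes A :: "complex^'n^'n"
  assumes ev: "\<And>z v. v \<noteq> 0 \<Longrightarrow> A *v v = z *s v \<Longrightarrow> cmod z < 1"
  shows "p \<noteq> 0 \<Longrightarrow> poly_act A p x = 0 \<Longrightarrow> (\<lambda>n. (((*v) A) ^^ n) x) \<longlonglongrightarrow> 0"
proof (induction "degree p" arbitrary: p x rule: less_induct)
  case less
  show ?case
  proof (cases "degree p = 0")
    case True
    then obtain c where p: "p = [:c:]" using degree_eq_zeroE by blast
    then have "x = 0" using less.prems by (auto simp: vec_eq_iff)
    moreover have "(((*v) A) ^^ n) 0 = 0" for n by (induction n) auto
    ultimately show ?thesis by simp
  next
    case False
    then have "\<not> constant (poly p)" by (simp add: constant_degree)
    then obtain z where "poly p z = 0" using fundamental_theorem_of_algebra by blast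
    then obtain q where p: "p = [:- z, 1:] * q" by (metis dvdE poly_eq_0_iff_dvd)
    with less.prems have q: "q \<noteq> 0" by auto
    then have deg: "degree q < degree p" by (simp only: p) (subst degree_mult_eq, auto)
    have root: "A *v poly_act A q x = z *s poly_act A q x"
      using less.prems(2) by (simp only: p poly_act_linear_factor) simp
    show ?thesis
    proof (cases "cmod z < 1")
      case True
      let ?y = "A *v x - z *s x"
      have "poly_act A q ?y = 0"
        using root by (simp add: poly_act_diff_arg poly_act_scale_arg flip: poly_act_commute)
      with less.hyps deg q have y: "(\<lambda>n. (((*v) A) ^^ n) ?y) \<longlonglongrightarrow> 0" by blast
      have step: "(((*v) A) ^^ Suc n) x = z *s (((*v) A) ^^ n) x + (((*v) A) ^^ n) ?y" for n
        by (induction n) (auto simp: vec.scale matrix_vector_right_distrib)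
      have "(\<lambda>n. norm ((((*v) A) ^^ n) x)) \<longlonglongrightarrow> 0"
      proof (rule contraction_limit)
        show "norm ((((*v) A) ^^ Suc n) x)
            \<le> cmod z * norm ((((*v) A) ^^ n) x) + norm ((((*v) A) ^^ n) ?y)" for n
          unfolding step by (rule order_trans[OF norm_triangle_ineq]) (simp add: norm_complex_scale)
        show "(\<lambda>n. norm ((((*v) A) ^^ n) ?y)) \<longlonglongrightarrow> 0"
          using y by (rule tendsto_norm_zero)
      qed (use True in auto)
      then show ?thesis by (rule tendsto_norm_zero_cancel)
    next
      case False
      with ev root have "poly_act A q x = 0" by blast
      with less.hyps deg q show ?thesis by blast
    qed
  qed
qed

lemma mat_pow_mult_vec: "mat_pow A n *v x = (((*v) A) ^^ n) x"
  by (induction n) (auto simp: mat_pow_def simp flip: matrix_vector_mul_assoc)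

text \<open>The eigenvalues of \<open>M\<^sup>-\<^sup>1\<close> are the inverses of those of \<open>M\<close>, hence lie in the open unit disc. The
passage to complex vectors preserves norms.\<close>

lemma expansive_inverse_powers:
  fixes M :: "real^'d^'d"
  assumes inv: "invertible M" and "expansive M"
  shows "(\<lambda>n. mat_pow (matrix_inv M) n *v x) \<longlonglongrightarrow> 0"
proof -
  let ?c = "map_matrix complex_of_real :: real^'d^'d \<Rightarrow> _"
  let ?v = "(\<lambda>x. \<chi> i. complex_of_real (x $ i)) :: real^'d \<Rightarrow> _"
  let ?A = "?c (matrix_inv M)"
  have "M ** matrix_inv M = mat 1"
    by (rule invertible_matrix_inv[OF inv])
  moreover have "?c (X ** Y) = ?c X ** ?c Y" for X Y
    by (simp add: vec_eq_iff matrix_matrix_mult_def map_matrix_def)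
  ultimately have "?c M ** ?A = ?c (mat 1)"
    by metis
  also have "\<dots> = mat 1"
    by (simp add: vec_eq_iff map_matrix_def mat_def)
  finally have MA: "?c M *v (?A *v v) = v" for v
    by (simp add: matrix_vector_mul_assoc)
  have "cmod z < 1" if v: "v \<noteq> 0" "?A *v v = z *s v" for z v
  proof -
    have v': "v = z *s (?c M *v v)"
      using MA[of v] v(2) by (simp add: vec.scale)
    with v(1) have z: "z \<noteq> 0" by auto
    then have "?c M *v v = inverse z *s v"
      by (subst (2) v') (simp add: vector_smult_assoc)
    with assms(2) v(1) have "1 < cmod (inverse z)"
      unfolding expansive_def by blast
    with z show ?thesis by (simp add: norm_inverse one_less_inverse_iff)
  qed
  moreover obtain p where "p \<noteq> 0" "poly_act ?A p (?v x) = 0"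
    by (rule annihilating_poly)
  ultimately have "(\<lambda>n. (((*v) ?A) ^^ n) (?v x)) \<longlonglongrightarrow> 0"
    by (intro powers_tendsto_0_if_annihilated)
  moreover have av: "?A *v ?v y = ?v (matrix_inv M *v y)" for y
    by (simp add: vec_eq_iff matrix_vector_mult_def map_matrix_def)
  have "(((*v) ?A) ^^ n) (?v x) = ?v (mat_pow (matrix_inv M) n *v x)" for n
    by (induction n) (simp_all add: mat_pow_mult_vec av)
  ultimately have "(\<lambda>n. norm (?v (mat_pow (matrix_inv M) n *v x))) \<longlonglongrightarrow> 0"
    by (simp add: tendsto_norm_zero)
  moreover have "norm (?v y) = norm y" for y
    by (simp add: norm_vec_def)
  ultimately show ?thesis
    by (simp add: tendsto_norm_zero_iff)
qed

text \<open>Convergence on the standard basis gives convergence in operator norm.\<close>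

lemma expansive_inverse_powers_uniform:
  fixes M :: "real^'d^'d"
  assumes "invertible M" "expansive M" "0 < r"
  obtains n where "\<And>x. norm (mat_pow (matrix_inv M) n *v x) \<le> r * norm x"
proof -
  let ?B = "mat_pow (matrix_inv M)"
  have "(\<lambda>n. \<Sum>i\<in>UNIV. norm (?B n *v axis i 1)) \<longlonglongrightarrow> (\<Sum>i\<in>(UNIV::'d set). 0)"
    by (intro tendsto_sum tendsto_norm_zero expansive_inverse_powers assms)
  then have "\<forall>\<^sub>F n in sequentially. (\<Sum>i\<in>UNIV. norm (?B n *v axis i 1)) < r"
    using assms(3) by (intro order_tendstoD(2)) auto
  then obtain n where n: "(\<Sum>i\<in>UNIV. norm (?B n *v axis i 1)) < r"
    unfolding eventually_sequentially by blast
  have "norm (?B n *v x) \<le> r * norm x" for x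
  proof -
    have "?B n *v x = ?B n *v (\<Sum>i\<in>UNIV. x $ i *s axis i 1)"
      by (simp add: basis_expansion)
    also have "\<dots> = (\<Sum>i\<in>UNIV. x $ i *s (?B n *v axis i 1))"
      by (simp add: vec.sum vec.scale)
    also have "norm \<dots> \<le> (\<Sum>i\<in>UNIV. norm x * norm (?B n *v axis i 1))"
      by (intro sum_norm_le) (simp add: scalar_mult_eq_scaleR mult_right_mono component_le_norm_cart)
    also have "\<dots> \<le> r * norm x"
      using mult_left_mono[OF less_imp_le[OF n], of "norm x"] by (simp add: mult.commute sum_distrib_left)
    finally show ?thesis .
  qed
  then show ?thesis by (rule that)
qed

section \<open>The real Hilbert space geometry of square-integrable functions\<close>

text \<open>The real part of the usual Hermitian inner product, by viewing the complex plane as \<open>\<real>\<^sup>2\<close>. The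
real inner product suffices because only scaling by real factors enters the orthogonality argument.\<close>

definition L2inner :: "(real^'d \<Rightarrow> complex) \<Rightarrow> (real^'d \<Rightarrow> complex) \<Rightarrow> real" where
  "L2inner f g = (\<integral>x. f x \<bullet> g x \<partial>lebesgue)"

lemma L2_measurable: "f \<in> L2 \<Longrightarrow> f \<in> borel_measurable lebesgue"
  by (simp add: L2_def)

lemma L2_integrable: "f \<in> L2 \<Longrightarrow> integrable lebesgue (\<lambda>x. (cmod (f x))\<^sup>2)"
  by (simp add: L2_def)

lemma L2norm_nonneg [simp]: "0 \<le> L2norm f"
  by (simp add: L2norm_def)

lemma L2norm_square: "(L2norm f)\<^sup>2 = (\<integral>x. (cmod (f x))\<^sup>2 \<partial>lebesgue)"
  by (simp add: L2norm_def)

lemma L2_add: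
  assumes "f \<in> L2" "g \<in> L2"
  shows "(\<lambda>x. f x + g x) \<in> L2"
proof -
  note [measurable] = L2_measurable[OF assms(1)] L2_measurable[OF assms(2)]
  have "integrable lebesgue (\<lambda>x. 2 * (cmod (f x))\<^sup>2 + 2 * (cmod (g x))\<^sup>2)"
    using assms by (simp add: L2_integrable)
  then have "integrable lebesgue (\<lambda>x. (cmod (f x + g x))\<^sup>2)"
  proof (rule Bochner_Integration.integrable_bound)
    have "(cmod (a + b))\<^sup>2 \<le> 2 * (cmod a)\<^sup>2 + 2 * (cmod b)\<^sup>2" for a b
      using power_mono[OF norm_triangle_ineq[of a b], of 2] sum_squares_bound[of "cmod a" "cmod b"]
      by (simp add: power2_sum)
    then show "AE x in lebesgue. norm ((cmod (f x + g x))\<^sup>2) \<le> norm (2 * (cmod (f x))\<^sup>2 + 2 * (cmod (g x))\<^sup>2)"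
      by simp
  qed measurable
  then show ?thesis by (simp add: L2_def)
qed

lemma L2_scale: "f \<in> L2 \<Longrightarrow> (\<lambda>x. c * f x) \<in> L2"
  by (auto simp: L2_def norm_mult power_mult_distrib)

lemma L2_diff: "f \<in> L2 \<Longrightarrow> g \<in> L2 \<Longrightarrow> (\<lambda>x. f x - g x) \<in> L2"
  using L2_add[of f "\<lambda>x. - 1 * g x"] L2_scale[of g "- 1"] by simp

lemma L2_sum: "(\<And>a. a \<in> S \<Longrightarrow> f a \<in> L2) \<Longrightarrow> (\<lambda>x. \<Sum>a\<in>S. f a x) \<in> L2"
proof (induction S rule: infinite_finite_induct)
  case (insert a S)
  then show ?case using L2_add[of "f a" "\<lambda>x. \<Sum>a\<in>S. f a x"] by simp
qed (auto simp: L2_def)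

lemma L2_lin_comb: "(\<And>a. a \<in> A \<Longrightarrow> e a \<in> L2) \<Longrightarrow> lin_comb e A c \<in> L2"
  unfolding lin_comb_def[abs_def] by (intro L2_sum L2_scale) (auto simp: supp_on_def)

lemma L2_restrict:
  assumes "f \<in> L2" and [measurable]: "B \<in> sets lebesgue"
  shows "(\<lambda>x. indicator B x *\<^sub>R f x) \<in> L2"
proof -
  note [measurable] = L2_measurable[OF assms(1)]
  have "integrable lebesgue (\<lambda>x. (cmod (indicator B x *\<^sub>R f x))\<^sup>2)"
    using L2_integrable[OF assms(1)]
    by (rule Bochner_Integration.integrable_bound) (auto split: split_indicator)
  then show ?thesis by (simp add: L2_def)
qed

lemma integrable_L2inner:
  assumes "f \<in> L2" "g \<in> L2"
  shows "integrable lebesgue (\<lambda>x. f x \<bullet> g x)"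
proof -
  note [measurable] = L2_measurable[OF assms(1)] L2_measurable[OF assms(2)]
  have "integrable lebesgue (\<lambda>x. (cmod (f x))\<^sup>2 + (cmod (g x))\<^sup>2)"
    using assms by (simp add: L2_integrable)
  then show ?thesis
  proof (rule Bochner_Integration.integrable_bound)
    have "\<bar>a \<bullet> b\<bar> \<le> (cmod a)\<^sup>2 + (cmod b)\<^sup>2" for a b
      using Cauchy_Schwarz_ineq2[of a b] sum_squares_bound[of "cmod a" "cmod b"]
        mult_nonneg_nonneg[of "cmod a" "cmod b"] by simp
    then show "AE x in lebesgue. norm (f x \<bullet> g x) \<le> norm ((cmod (f x))\<^sup>2 + (cmod (g x))\<^sup>2)"
      by simp
  qed measurable
qed

lemma L2inner_add_right:
  "f \<in> L2 \<Longrightarrow> g \<in> L2 \<Longrightarrow> h \<in> L2 \<Longrightarrow> L2inner f (\<lambda>x. g x + h x) = L2inner f g + L2inner f h"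
  by (simp add: L2inner_def inner_add_right integrable_L2inner)

lemma L2inner_self: "L2inner f f = (L2norm f)\<^sup>2"
  by (simp add: L2inner_def L2norm_square power2_norm_eq_inner)

lemma L2norm_square_minus_scaleR:
  assumes "f \<in> L2" "g \<in> L2"
  shows "(L2norm (\<lambda>x. f x - t *\<^sub>R g x))\<^sup>2 = (L2norm f)\<^sup>2 - 2 * t * L2inner f g + t\<^sup>2 * (L2norm g)\<^sup>2"
proof -
  have "(cmod (f x - t *\<^sub>R g x))\<^sup>2 = f x \<bullet> f x - 2 * t * (f x \<bullet> g x) + t\<^sup>2 * (g x \<bullet> g x)" for x
    unfolding power2_norm_eq_inner
    by (simp add: inner_diff inner_commute power2_eq_square algebra_simps)
  then show ?thesis
    using assms by (simp add: L2norm_square integrable_L2inner L2inner_def power2_norm_eq_inner)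
qed

lemma nonneg_quadratic_discriminant:
  fixes a b c :: real
  assumes "\<And>t. 0 \<le> a - 2 * t * b + t\<^sup>2 * c" and "0 \<le> c"
  shows "b\<^sup>2 \<le> a * c"
proof (cases "c = 0")
  case True
  \<comment> \<open>Otherwise the expression is affine in \<open>t\<close> with nonzero slope; at the chosen \<open>t\<close> it is \<open>- 1\<close>.\<close>
  have "b = 0"
  proof (rule ccontr)
    assume "b \<noteq> 0"
    then show False using assms(1)[of "(a + 1) / (2 * b)"] True by simp
  qed
  with True show ?thesis by simp
next
  case False
  then show ?thesis using assms(1)[of "b / c"] assms(2) by (simp add: field_simps power2_eq_square)
qed

text \<open>The quadratic polynomial \<open>\<parallel>f - t g\<parallel>\<^sup>2 - D\<close> in \<open>t\<close> is nonnegative, so its discriminant is not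
positive. The case \<open>D = 0\<close> is the Cauchy-Schwarz inequality.\<close>

lemma near_minimizer_almost_orthogonal:
  assumes "f \<in> L2" "g \<in> L2" and "\<And>t. D \<le> (L2norm (\<lambda>x. f x - t *\<^sub>R g x))\<^sup>2"
  shows "(L2inner f g)\<^sup>2 \<le> ((L2norm f)\<^sup>2 - D) * (L2norm g)\<^sup>2"
  by (rule nonneg_quadratic_discriminant)
    (use assms(3) L2norm_square_minus_scaleR[OF assms(1,2)] in \<open>auto simp: algebra_simps\<close>)

lemma L2_Cauchy_Schwarz:
  assumes "f \<in> L2" "g \<in> L2"
  shows "\<bar>L2inner f g\<bar> \<le> L2norm f * L2norm g"
proof (rule power2_le_imp_le)
  show "\<bar>L2inner f g\<bar>\<^sup>2 \<le> (L2norm f * L2norm g)\<^sup>2"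
    using near_minimizer_almost_orthogonal[OF assms, of 0] by (simp add: power_mult_distrib)
qed simp

lemma L2norm_triangle_diff:
  assumes "f \<in> L2" "g \<in> L2"
  shows "L2norm (\<lambda>x. f x - g x) \<le> L2norm f + L2norm g"
proof (rule power2_le_imp_le)
  have "(L2norm (\<lambda>x. f x - g x))\<^sup>2 = (L2norm f)\<^sup>2 - 2 * L2inner f g + (L2norm g)\<^sup>2"
    using L2norm_square_minus_scaleR[OF assms, of 1] by simp
  then show "(L2norm (\<lambda>x. f x - g x))\<^sup>2 \<le> (L2norm f + L2norm g)\<^sup>2"
    using L2_Cauchy_Schwarz[OF assms] by (simp add: power2_sum)
qed simp

lemma L2_dilate:
  assumes "invertible U" "f \<in> L2"
  shows "dilate U k f \<in> L2" and L2norm_dilate: "L2norm (dilate U k f) = L2norm f"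
proof -
  note [measurable] = L2_measurable[OF assms(2)]
  note [measurable] = measurable_affine_matrix[OF assms(1), of k]
  have sq: "(cmod (dilate U k f x))\<^sup>2 = \<bar>det U\<bar> * (cmod (f (U *v x - k)))\<^sup>2" for x
    by (simp add: dilate_def norm_mult power_mult_distrib)
  have m: "(\<lambda>x. (cmod (f x))\<^sup>2) \<in> borel_measurable lebesgue" by measurable
  note F = integral_affine_matrix[OF assms(1) m, of k]
  have "dilate U k f \<in> borel_measurable lebesgue"
    unfolding dilate_def[abs_def] by measurable
  then show "dilate U k f \<in> L2"
    using F(1) L2_integrable[OF assms(2)] by (simp add: L2_def sq)
  show "L2norm (dilate U k f) = L2norm f"
    using F(2) by (simp add: L2norm_def sq)
qed

section \<open>Riesz systems under a unitary dilation\<close>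

lemma supp_on_subset: "supp_on A c \<subseteq> A"
  by (auto simp: supp_on_def)

lemma lin_comb_eq_sum:
  assumes "finite F" "supp_on A c \<subseteq> F" "F \<subseteq> A"
  shows "lin_comb e A c x = (\<Sum>a\<in>F. c a * e a x)"
  unfolding lin_comb_def by (rule sum.mono_neutral_left) (use assms in \<open>auto simp: supp_on_def\<close>)

context
  fixes \<sigma> :: "'a \<Rightarrow> 'b" and A B and U :: "real^'d^'d"
    and e :: "'a \<Rightarrow> real^'d \<Rightarrow> complex" and e' :: "'b \<Rightarrow> real^'d \<Rightarrow> complex"
  assumes bij: "bij_betw \<sigma> A B" and inv: "invertible U"
    and e': "\<And>a. a \<in> A \<Longrightarrow> e' (\<sigma> a) = dilate U 0 (e a)"
    and e: "\<And>a. a \<in> A \<Longrightarrow> e a \<in> L2"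
begin

lemma supp_on_reindex: "supp_on B c = \<sigma> ` supp_on A (c \<circ> \<sigma>)"
  using bij by (auto simp: supp_on_def bij_betw_def)

lemma inj_on_supp: "inj_on \<sigma> (supp_on A c)"
  using bij supp_on_subset by (metis bij_betw_def inj_on_subset)

lemma finite_supp_on_reindex: "finite (supp_on B c) \<longleftrightarrow> finite (supp_on A (c \<circ> \<sigma>))"
  by (simp add: supp_on_reindex finite_image_iff inj_on_supp)

lemma lin_comb_reindex: "lin_comb e' B c = dilate U 0 (lin_comb e A (c \<circ> \<sigma>))"
proof
  fix x
  show "lin_comb e' B c x = dilate U 0 (lin_comb e A (c \<circ> \<sigma>)) x"
    unfolding lin_comb_def supp_on_reindex
    by (subst sum.reindex[OF inj_on_supp], unfold o_def)
      (auto simp: dilate_def sum_distrib_left supp_on_def e' intro!: sum.cong)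
qed

lemma coefficient_sum_reindex:
  "(\<Sum>b\<in>supp_on B c. (cmod (c b))\<^sup>2) = (\<Sum>a\<in>supp_on A (c \<circ> \<sigma>). (cmod ((c \<circ> \<sigma>) a))\<^sup>2)"
  unfolding supp_on_reindex by (simp add: sum.reindex[OF inj_on_supp])

lemma L2norm_lin_comb_reindex: "L2norm (lin_comb e' B c) = L2norm (lin_comb e A (c \<circ> \<sigma>))"
  by (simp add: lin_comb_reindex L2norm_dilate[OF inv] L2_lin_comb e)

text \<open>A linear combination of the target family is the dilation of the combination of the source family
with the same coefficients, so both sides of the Riesz inequalities agree.\<close>

lemma riesz_lower_dilate: "riesz_lower C e A \<Longrightarrow> riesz_lower C e' B"
  unfolding riesz_lower_def finite_supp_on_reindex coefficient_sum_reindex L2norm_lin_comb_reindex by blast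

lemma riesz_upper_dilate: "riesz_upper C e A \<Longrightarrow> riesz_upper C e' B"
  unfolding riesz_upper_def finite_supp_on_reindex coefficient_sum_reindex L2norm_lin_comb_reindex by blast

text \<open>Approximating the inverse dilation of \<open>f\<close> in the source system and dilating back preserves the
error.\<close>

lemma dense_span_dilate:
  assumes dense: "dense_span e A"
  shows "dense_span e' B"
  unfolding dense_span_def
proof (intro ballI allI impI)
  fix f :: "real^'d \<Rightarrow> complex" and \<epsilon> :: real
  assume f: "f \<in> L2" and "0 < \<epsilon>"
  define g where "g = dilate (matrix_inv U) 0 f"
  have inv': "invertible (matrix_inv U)"
    using invertible_matrix_inv[OF inv] by (auto simp: invertible_def)
  have g: "g \<in> L2" unfolding g_def by (rule L2_dilate[OF inv' f])
  have "det U * det (matrix_inv U) = 1"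
    by (metis inv det_I det_mul invertible_matrix_inv(1))
  then have "sqrt \<bar>det U\<bar> * sqrt \<bar>det (matrix_inv U)\<bar> = 1"
    by (simp flip: real_sqrt_mult abs_mult)
  then have fg: "dilate U 0 g x = f x" for x
    by (simp add: g_def dilate_def invertible_mult_inv_vec[OF inv] flip: mult.assoc of_real_mult)
  obtain c where c: "finite (supp_on A c)" "L2norm (\<lambda>x. g x - lin_comb e A c x) < \<epsilon>"
    using dense g \<open>0 < \<epsilon>\<close> unfolding dense_span_def by blast
  define c' where "c' = c \<circ> inv_into A \<sigma>"
  have "(c' \<circ> \<sigma>) a = c a" if "a \<in> A" for a
    using bij that by (simp add: c'_def bij_betw_def)
  then have s: "supp_on A (c' \<circ> \<sigma>) = supp_on A c" and "lin_comb e A (c' \<circ> \<sigma>) = lin_comb e A c"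
    by (auto simp: supp_on_def lin_comb_def fun_eq_iff intro!: sum.cong)
  then have "f x - lin_comb e' B c' x = dilate U 0 (\<lambda>x. g x - lin_comb e A c x) x" for x
    by (simp add: lin_comb_reindex dilate_def right_diff_distrib flip: fg)
  moreover have "(\<lambda>x. g x - lin_comb e A c x) \<in> L2"
    by (intro L2_diff g L2_lin_comb e)
  ultimately have "L2norm (\<lambda>x. f x - lin_comb e' B c' x) < \<epsilon>"
    using c(2) L2norm_dilate[OF inv, of "\<lambda>x. g x - lin_comb e A c x" 0] by presburger
  then show "\<exists>c. finite (supp_on B c) \<and> L2norm (\<lambda>x. f x - lin_comb e' B c x) < \<epsilon>"
    using c(1) s by (metis finite_supp_on_reindex)
qed

end

section \<open>Changing the coarsest scale of a nonhomogeneous system\<close>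

lemma mat_pow_Suc: "mat_pow A (Suc n) = A ** mat_pow A n"
  by (simp add: mat_pow_def)

lemma mat_pow_0 [simp]: "mat_pow A 0 = mat 1"
  by (simp add: mat_pow_def)

lemma mat_powi_0 [simp]: "mat_powi A 0 = mat 1"
  by (simp add: mat_powi_def)

lemma mat_powi_succ:
  assumes "invertible M"
  shows "mat_powi M (j + 1) = M ** mat_powi M j"
proof (cases "0 \<le> j")
  case True
  then show ?thesis by (simp add: mat_powi_def mat_pow_Suc nat_add_distrib)
next
  case False
  define m where "m = nat (- j - 1)"
  have j: "j = - int m - 1" using False by (simp add: m_def)
  have "mat_powi M (j + 1) = mat_pow (matrix_inv M) m"
    by (cases "m = 0") (auto simp: j mat_powi_def)
  moreover have "mat_powi M j = matrix_inv M ** mat_pow (matrix_inv M) m"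
    by (simp add: j mat_powi_def flip: mat_pow_Suc) (simp add: nat_add_distrib)
  ultimately show ?thesis
    by (simp add: matrix_mul_assoc invertible_matrix_inv[OF assms])
qed

lemma mat_powi_pred:
  assumes "invertible M"
  shows "mat_powi M (j - 1) = matrix_inv M ** mat_powi M j"
  using mat_powi_succ[OF assms, of "j - 1"]
  by (simp add: matrix_mul_assoc invertible_matrix_inv[OF assms])

lemma mat_powi_add:
  assumes "invertible M"
  shows "mat_powi M (i + j) = mat_powi M i ** mat_powi M j"
proof (induction i rule: int_induct[where k = 0])
  case (step1 i)
  then show ?case using mat_powi_succ[OF assms, of i] mat_powi_succ[OF assms, of "i + j"]
    by (simp add: algebra_simps flip: matrix_mul_assoc)
next
  case (step2 i)
  then show ?case using mat_powi_pred[OF assms, of i] mat_powi_pred[OF assms, of "i + j"]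
    by (simp add: algebra_simps flip: matrix_mul_assoc)
qed simp

lemma invertible_mat_powi:
  assumes "invertible M"
  shows "invertible (mat_powi M j)"
proof -
  have "mat_powi M j ** mat_powi M (- j) = mat 1" "mat_powi M (- j) ** mat_powi M j = mat 1"
    by (simp_all flip: mat_powi_add[OF assms])
  then show ?thesis unfolding invertible_def by blast
qed

text \<open>This is where \<open>M\<^bsup>j+n\<^esup> = M\<^sup>j M\<^sup>n\<close> enters: dilating by \<open>M\<^sup>n\<close> leaves the translation \<open>k\<close> unchanged and
shifts the scale only.\<close>

lemma dilate_dilate:
  assumes "invertible M"
  shows "dilate (mat_powi M n) 0 (dilate (mat_powi M j) k f) = dilate (mat_powi M (j + n)) k f"
  by (simp add: fun_eq_iff dilate_def mat_powi_add[OF assms] det_mul abs_mult real_sqrt_mult matrix_vector_mul_assoc)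

definition shift_index ::
  "int \<Rightarrow> ('i \<times> (real^'d)) + (int \<times> 'l \<times> (real^'d)) \<Rightarrow> ('i \<times> (real^'d)) + (int \<times> 'l \<times> (real^'d))" where
  "shift_index n = map_sum id (\<lambda>(j, l, k). (j + n, l, k))"

lemma bij_betw_shift_index:
  "bij_betw (shift_index n) (nonhom_index J I L) (nonhom_index (J + n) I L)"
  by (rule bij_betw_byWitness[where f' = "shift_index (- n)"])
    (auto simp: shift_index_def nonhom_index_def)

lemma nonhom_system_shift:
  assumes "invertible M"
  shows "nonhom_system M (J + n) \<phi> \<psi> (shift_index n a) = dilate (mat_powi M n) 0 (nonhom_system M J \<phi> \<psi> a)"
  by (cases a) (auto simp: nonhom_system_def hom_system_def shift_index_def dilate_dilate[OF assms])

lemma L2_nonhom_system: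
  assumes "invertible M" "\<forall>i\<in>I. \<phi> i \<in> L2" "\<forall>l\<in>L. \<psi> l \<in> L2" "a \<in> nonhom_index J I L"
  shows "nonhom_system M J \<phi> \<psi> a \<in> L2"
  using assms(2-)
  by (auto simp: nonhom_index_def nonhom_system_def hom_system_def
      intro!: L2_dilate invertible_mat_powi[OF assms(1)])

lemma nonhom_riesz_shift:
  assumes "invertible M" "\<forall>i\<in>I. \<phi> i \<in> L2" "\<forall>l\<in>L. \<psi> l \<in> L2"
  shows "riesz_lower C (nonhom_system M J \<phi> \<psi>) (nonhom_index J I L) \<longleftrightarrow>
      riesz_lower C (nonhom_system M J' \<phi> \<psi>) (nonhom_index J' I L)" (is "?l J \<longleftrightarrow> ?l J'")
    and "riesz_upper C (nonhom_system M J \<phi> \<psi>) (nonhom_index J I L) \<longleftrightarrow>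
      riesz_upper C (nonhom_system M J' \<phi> \<psi>) (nonhom_index J' I L)" (is "?u J \<longleftrightarrow> ?u J'")
    and "dense_span (nonhom_system M J \<phi> \<psi>) (nonhom_index J I L) \<longleftrightarrow>
      dense_span (nonhom_system M J' \<phi> \<psi>) (nonhom_index J' I L)" (is "?d J \<longleftrightarrow> ?d J'")
proof -
  note tr = bij_betw_shift_index invertible_mat_powi[OF assms(1)] nonhom_system_shift[OF assms(1)]
    L2_nonhom_system[OF assms]
  have "?l (J + n)" if "?l J" for J n by (rule riesz_lower_dilate[OF tr that])
  from this[of J "J' - J"] this[of J' "J - J'"] show "?l J \<longleftrightarrow> ?l J'" by auto
  have "?u (J + n)" if "?u J" for J n by (rule riesz_upper_dilate[OF tr that])
  from this[of J "J' - J"] this[of J' "J - J'"] show "?u J \<longleftrightarrow> ?u J'" by auto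
  have "?d (J + n)" if "?d J" for J n by (rule dense_span_dilate[OF tr that])
  from this[of J "J' - J"] this[of J' "J - J'"] show "?d J \<longleftrightarrow> ?d J'" by auto
qed

section \<open>Mass near the integer lattice\<close>

lemma int_points_separated:
  assumes "k \<in> int_points" "k' \<in> int_points" "norm (k - k') < 1"
  shows "k = (k' :: real^'d)"
proof -
  have "k $ i = k' $ i" for i
  proof -
    have "k $ i - k' $ i \<in> \<int>" using assms(1,2) by (auto simp: int_points_def)
    moreover have "\<bar>k $ i - k' $ i\<bar> < 1"
      using component_le_norm_cart[of "k - k'" i] assms(3) by simp
    ultimately show ?thesis using Ints_nonzero_abs_less1 by fastforce
  qed
  then show ?thesis by (simp add: vec_eq_iff)
qed

lemma closed_int_points: "closed (int_points :: (real^'d) set)"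
  by (rule discrete_imp_closed[of 1]) (auto intro: int_points_separated simp: dist_norm)

lemma negligible_int_points: "negligible (int_points :: (real^'d) set)"
proof (rule negligible_subset)
  fix i :: 'd
  have "negligible {x::real^'d. x $ i = of_int n}" for n :: int
    using negligible_hyperplane[of "axis i 1 :: real^'d" "of_int n"]
    by (simp add: inner_axis' axis_eq_0_iff)
  then show "negligible (\<Union>n::int. {x::real^'d. x $ i = of_int n})"
    by (intro negligible_countable_Union) auto
  show "int_points \<subseteq> (\<Union>n::int. {x::real^'d. x $ i = of_int n})"
    by (auto simp: int_points_def elim!: Ints_cases)
qed

definition lattice_nbhd :: "real \<Rightarrow> (real^'d) set" where
  "lattice_nbhd r = (\<Union>k\<in>int_points. ball k r)"

lemma lattice_nbhd_measurable [measurable, simp]: "(lattice_nbhd r :: (real^'d) set) \<in> sets lebesgue"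
proof -
  have "open (lattice_nbhd r :: (real^'d) set)" unfolding lattice_nbhd_def by (intro open_UN) simp
  then show ?thesis by (intro sets_completionI_sets) (simp add: borel_open)
qed

definition mass_on :: "(real^'d) set \<Rightarrow> (real^'d \<Rightarrow> complex) \<Rightarrow> real" where
  "mass_on B f = (\<integral>x. indicator B x * (cmod (f x))\<^sup>2 \<partial>lebesgue)"

lemma integrable_mass_on:
  assumes "f \<in> L2" and [measurable]: "B \<in> sets lebesgue"
  shows "integrable lebesgue (\<lambda>x. indicator B x * (cmod (f x))\<^sup>2)"
  using integrable_mult_indicator[OF assms(2) L2_integrable[OF assms(1)]] by simp

lemma mass_on_nonneg: "0 \<le> mass_on B f"
  unfolding mass_on_def by (rule integral_nonneg_AE) simp

lemma mass_on_le_L2norm: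
  assumes "f \<in> L2" "B \<in> sets lebesgue"
  shows "mass_on B f \<le> (L2norm f)\<^sup>2"
  unfolding mass_on_def L2norm_square
  by (rule integral_mono[OF integrable_mass_on[OF assms] L2_integrable[OF assms(1)]])
    (simp split: split_indicator)

lemma L2norm_restrict: "(L2norm (\<lambda>x. indicator B x *\<^sub>R f x))\<^sup>2 = mass_on B f"
  unfolding L2norm_square mass_on_def by (rule Bochner_Integration.integral_cong) (auto split: split_indicator)

lemma mass_on_tendsto_0:
  fixes f :: "real^'d \<Rightarrow> complex"
  assumes f: "f \<in> L2" and B: "\<And>n. B n \<in> sets lebesgue"
    and AE: "AE x in lebesgue. \<forall>\<^sub>F n in sequentially. x \<notin> B n"
  shows "(\<lambda>n. mass_on (B n) f) \<longlonglongrightarrow> 0"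
proof -
  have "(\<lambda>n. \<integral>x. indicator (B n) x * (cmod (f x))\<^sup>2 \<partial>lebesgue) \<longlonglongrightarrow> integral\<^sup>L lebesgue (\<lambda>x::real^'d. 0)"
  proof (rule integral_dominated_convergence)
    show "integrable lebesgue (\<lambda>x. (cmod (f x))\<^sup>2)" by (rule L2_integrable[OF f])
    show "AE x in lebesgue. (\<lambda>n. indicator (B n) x * (cmod (f x))\<^sup>2) \<longlonglongrightarrow> 0"
      using AE
    proof eventually_elim
      case (elim x)
      then have "\<forall>\<^sub>F n in sequentially. indicator (B n) x * (cmod (f x))\<^sup>2 = 0"
        by eventually_elim simp
      then show ?case by (rule tendsto_eventually)
    qed
    show "AE x in lebesgue. norm (indicator (B n) x * (cmod (f x))\<^sup>2) \<le> (cmod (f x))\<^sup>2" for n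
      by (simp split: split_indicator)
    show "(\<lambda>x. indicator (B n) x * (cmod (f x))\<^sup>2) \<in> borel_measurable lebesgue" for n
      using borel_measurable_integrable[OF integrable_mass_on[OF f B]] .
  qed simp
  then show ?thesis by (simp add: mass_on_def)
qed

text \<open>The neighbourhoods shrink to the lattice itself, which is closed and null. Radii start at \<open>1/2\<close>,
the largest for which balls about different lattice points are disjoint.\<close>

lemma mass_on_lattice_nbhd_tendsto_0:
  assumes "f \<in> L2"
  shows "(\<lambda>n. mass_on (lattice_nbhd (1 / (real n + 2))) f) \<longlonglongrightarrow> 0"
proof (rule mass_on_tendsto_0[OF assms])
  have "AE x in lebesgue. x \<notin> (int_points :: (real^'d) set)"
    using negligible_int_points by (intro AE_not_in) (simp add: negligible_iff_null_sets)
  then show "AE x in lebesgue. \<forall>\<^sub>F n in sequentially. x \<notin> (lattice_nbhd (1 / (real n + 2)) :: (real^'d) set)"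
  proof eventually_elim
    case (elim x)
    then obtain e where e: "0 < e" "ball x e \<subseteq> - int_points"
      using closed_int_points by (metis open_Compl openE ComplI)
    have "(\<lambda>n. 1 / (real n + 2)) \<longlonglongrightarrow> 0" by real_asymp
    then have "\<forall>\<^sub>F n in sequentially. 1 / (real n + 2) < e"
      using e(1) by (rule order_tendstoD(2))
    then show ?case
    proof eventually_elim
      case (elim n)
      show ?case
      proof
        assume "x \<in> lattice_nbhd (1 / (real n + 2))"
        then obtain k where "k \<in> int_points" "dist k x < 1 / (real n + 2)"
          by (auto simp: lattice_nbhd_def)
        then have "k \<in> ball x e" using elim by (simp add: dist_commute)
        with e(2) \<open>k \<in> int_points\<close> show False by blast
      qed
    qed
  qed
qed (rule lattice_nbhd_measurable)

lemma summable_on_small_tail: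
  fixes a :: "'i \<Rightarrow> real"
  assumes "a summable_on I" "0 < \<eta>"
  obtains G0 where "finite G0" "G0 \<subseteq> I" "\<And>G. finite G \<Longrightarrow> G \<subseteq> I - G0 \<Longrightarrow> sum a G < \<eta>"
proof -
  obtain s where "(sum a \<longlongrightarrow> s) (finite_subsets_at_top I)"
    using assms(1) by (auto simp: summable_on_def has_sum_def)
  then have "\<forall>\<^sub>F G in finite_subsets_at_top I. dist (sum a G) s < \<eta> / 2"
    using assms(2) by (intro tendstoD) auto
  then have "\<exists>G0. finite G0 \<and> G0 \<subseteq> I \<and>
      (\<forall>G. finite G \<and> G0 \<subseteq> G \<and> G \<subseteq> I \<longrightarrow> dist (sum a G) s < \<eta> / 2)"
    by (simp only: eventually_finite_subsets_at_top)
  then obtain G0 where G0: "finite G0" "G0 \<subseteq> I"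
    and close: "\<forall>G. finite G \<and> G0 \<subseteq> G \<and> G \<subseteq> I \<longrightarrow> dist (sum a G) s < \<eta> / 2"
    by (elim exE conjE)
  show ?thesis
  proof (rule that[OF G0])
    fix G assume G: "finite G" "G \<subseteq> I - G0"
    then have "sum a (G0 \<union> G) = sum a G0 + sum a G"
      using G0 by (intro sum.union_disjoint) auto
    moreover have "dist (sum a (G0 \<union> G)) s < \<eta> / 2" using G G0 by (intro close[rule_format]) auto
    moreover have "dist (sum a G0) s < \<eta> / 2" using G0 by (intro close[rule_format]) auto
    ultimately show "sum a G < \<eta>" unfolding dist_real_def by linarith
  qed
qed

text \<open>Finitely many generators are handled by the limit for a single function; the remaining ones
have small total mass by summability.\<close>

lemma uniformly_small_mass_near_lattice:
  fixes \<phi> :: "'i \<Rightarrow> real^'d \<Rightarrow> complex"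
  assumes L2: "\<forall>i\<in>I. \<phi> i \<in> L2" and sm: "(\<lambda>i. (L2norm (\<phi> i))\<^sup>2) summable_on I" and "0 < \<eta>"
  obtains r where "0 < r" "r \<le> 1/2"
    "\<And>G. finite G \<Longrightarrow> G \<subseteq> I \<Longrightarrow> (\<Sum>i\<in>G. mass_on (lattice_nbhd r) (\<phi> i)) \<le> \<eta>"
proof -
  obtain G0 where G0: "finite G0" "G0 \<subseteq> I"
    and tail: "\<And>G. finite G \<Longrightarrow> G \<subseteq> I - G0 \<Longrightarrow> (\<Sum>i\<in>G. (L2norm (\<phi> i))\<^sup>2) < \<eta> / 2"
    using summable_on_small_tail[OF sm half_gt_zero[OF \<open>0 < \<eta>\<close>]] by blast
  have "(\<lambda>n. \<Sum>i\<in>G0. mass_on (lattice_nbhd (1 / (real n + 2))) (\<phi> i)) \<longlonglongrightarrow> (\<Sum>i\<in>G0. 0)"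
    using G0 L2 by (intro tendsto_sum mass_on_lattice_nbhd_tendsto_0) auto
  then have "\<forall>\<^sub>F n in sequentially. (\<Sum>i\<in>G0. mass_on (lattice_nbhd (1 / (real n + 2))) (\<phi> i)) < \<eta> / 2"
    using \<open>0 < \<eta>\<close> by (intro order_tendstoD(2)) auto
  then obtain n where n: "(\<Sum>i\<in>G0. mass_on (lattice_nbhd (1 / (real n + 2))) (\<phi> i)) < \<eta> / 2"
    unfolding eventually_sequentially by blast
  let ?m = "\<lambda>i. mass_on (lattice_nbhd (1 / (real n + 2))) (\<phi> i)"
  show ?thesis
  proof (rule that)
    fix G assume G: "finite G" "G \<subseteq> I"
    have "sum ?m G = sum ?m (G \<inter> G0) + sum ?m (G - G0)"
      using G(1) by (rule sum.Int_Diff)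
    also have "sum ?m (G \<inter> G0) \<le> sum ?m G0"
      using G0 by (intro sum_mono2) (auto simp: mass_on_nonneg)
    also have "sum ?m (G - G0) \<le> (\<Sum>i\<in>G - G0. (L2norm (\<phi> i))\<^sup>2)"
      using G L2 by (intro sum_mono mass_on_le_L2norm) auto
    also have "\<dots> < \<eta> / 2" using G by (intro tail) auto
    finally show "sum ?m G \<le> \<eta>" using n by simp
  qed (auto simp: field_simps)
qed

text \<open>Substituting \<open>y = U x - k\<close> moves the mass on \<open>B\<close> to the set \<open>U B - k\<close>, which lies in a ball about
the lattice point \<open>- k\<close>.\<close>

lemma mass_on_dilate_le:
  assumes inv: "invertible U" and f: "f \<in> L2" and [measurable]: "B \<in> sets lebesgue"
    and sub: "\<And>x. x \<in> B \<Longrightarrow> U *v x \<in> ball 0 r"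
  shows "mass_on B (dilate U k f) \<le> mass_on (ball (- k) r) f"
proof -
  let ?F = "\<lambda>y. indicator (ball (- k) r) y * (cmod (f y))\<^sup>2"
  have i: "integrable lebesgue ?F" by (rule integrable_mass_on[OF f]) simp
  then have m: "?F \<in> borel_measurable lebesgue" by (rule borel_measurable_integrable)
  have "mass_on B (dilate U k f) \<le> (\<integral>x. \<bar>det U\<bar> * ?F (U *v x - k) \<partial>lebesgue)"
    unfolding mass_on_def
  proof (rule integral_mono)
    show "integrable lebesgue (\<lambda>x. indicator B x * (cmod (dilate U k f x))\<^sup>2)"
      by (intro integrable_mass_on L2_dilate inv f) simp
    show "integrable lebesgue (\<lambda>x. \<bar>det U\<bar> * ?F (U *v x - k))"
      using integral_affine_matrix(1)[OF inv m] i by blast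
    show "indicator B x * (cmod (dilate U k f x))\<^sup>2 \<le> \<bar>det U\<bar> * ?F (U *v x - k)" for x
      using sub[of x] by (auto simp: dilate_def norm_mult power_mult_distrib dist_norm split: split_indicator)
  qed
  also have "\<dots> = mass_on (ball (- k) r) f"
    unfolding mass_on_def by (rule integral_affine_matrix(2)[OF inv m])
  finally show ?thesis .
qed

lemma sum_mass_on_balls_le:
  assumes f: "f \<in> L2" and K: "finite K" "K \<subseteq> int_points" and r: "r \<le> 1/2"
  shows "(\<Sum>k\<in>K. mass_on (ball (- k) r) f) \<le> mass_on (lattice_nbhd r) f"
proof -
  have i: "integrable lebesgue (\<lambda>x. indicator (ball (- k) r) x * (cmod (f x))\<^sup>2)" for k
    by (rule integrable_mass_on[OF f]) simp
  have neg: "- k \<in> int_points" if "k \<in> K" for k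
    using K(2) that by (auto simp: int_points_def)
  \<comment> \<open>Distinct lattice points have distance at least one, and the radius is at most \<open>1/2\<close>.\<close>
  have "disjoint_family_on (\<lambda>k. ball (- k) r) K"
    unfolding disjoint_family_on_def
  proof (intro ballI impI)
    fix k k' assume kk: "k \<in> K" "k' \<in> K" "k \<noteq> k'"
    show "ball (- k) r \<inter> ball (- k') r = {}"
    proof (rule ccontr)
      assume "ball (- k) r \<inter> ball (- k') r \<noteq> {}"
      then obtain x where "dist (- k) x < r" "dist (- k') x < r" by auto
      then have "dist (- k) (- k') < 1" using r dist_triangle2[of "- k" "- k'" x] by linarith
      then have "- k = - k'"
        using int_points_separated[of "- k" "- k'"] neg kk by (simp add: dist_norm)
      with kk show False by simp
    qed
  qed
  then have sum_ind: "(\<Sum>k\<in>K. indicator (ball (- k) r) x) = (indicator (\<Union>k\<in>K. ball (- k) r) x :: real)" for x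
    using K(1) by (simp add: indicator_UN_disjoint)
  have "(\<Sum>k\<in>K. mass_on (ball (- k) r) f) = (\<integral>x. (\<Sum>k\<in>K. indicator (ball (- k) r) x * (cmod (f x))\<^sup>2) \<partial>lebesgue)"
    unfolding mass_on_def using i by (simp add: Bochner_Integration.integral_sum)
  also have "\<dots> \<le> mass_on (lattice_nbhd r) f"
    unfolding mass_on_def
  proof (rule integral_mono)
    show "integrable lebesgue (\<lambda>x. \<Sum>k\<in>K. indicator (ball (- k) r) x * (cmod (f x))\<^sup>2)"
      using i by (intro Bochner_Integration.integrable_sum)
    show "integrable lebesgue (\<lambda>x. indicator (lattice_nbhd r) x * (cmod (f x))\<^sup>2)"
      by (rule integrable_mass_on[OF f]) simp
    show "(\<Sum>k\<in>K. indicator (ball (- k) r) x * (cmod (f x))\<^sup>2) \<le> indicator (lattice_nbhd r) x * (cmod (f x))\<^sup>2" for x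
      unfolding sum_distrib_right[symmetric] sum_ind
      using neg by (intro mult_right_mono) (auto simp: lattice_nbhd_def split: split_indicator)
  qed
  finally show ?thesis .
qed

text \<open>The Cauchy-Schwarz inequality for the finite sum, applied pointwise and then integrated over \<open>B\<close>.\<close>

lemma mass_on_sum_le:
  assumes e: "\<And>a. a \<in> F \<Longrightarrow> e a \<in> L2" and F: "finite F" and B: "B \<in> sets lebesgue"
  shows "mass_on B (\<lambda>x. \<Sum>a\<in>F. c a * e a x) \<le> (\<Sum>a\<in>F. (cmod (c a))\<^sup>2) * (\<Sum>a\<in>F. mass_on B (e a))"
proof -
  let ?S = "\<Sum>a\<in>F. (cmod (c a))\<^sup>2"
  have i: "integrable lebesgue (\<lambda>x. indicator B x * (cmod (e a x))\<^sup>2)" if "a \<in> F" for a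
    by (rule integrable_mass_on[OF e[OF that] B])
  have pt: "(cmod (\<Sum>a\<in>F. c a * e a x))\<^sup>2 \<le> ?S * (\<Sum>a\<in>F. (cmod (e a x))\<^sup>2)" for x
  proof -
    have "cmod (\<Sum>a\<in>F. c a * e a x) \<le> (\<Sum>a\<in>F. cmod (c a) * cmod (e a x))"
      by (rule order_trans[OF norm_sum]) (simp add: norm_mult)
    then have "(cmod (\<Sum>a\<in>F. c a * e a x))\<^sup>2 \<le> (\<Sum>a\<in>F. cmod (c a) * cmod (e a x))\<^sup>2"
      by (rule power_mono) simp
    also have "\<dots> \<le> ?S * (\<Sum>a\<in>F. (cmod (e a x))\<^sup>2)"
      by (rule Cauchy_Schwarz_ineq_sum)
    finally show ?thesis .
  qed
  have "mass_on B (\<lambda>x. \<Sum>a\<in>F. c a * e a x)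
      \<le> (\<integral>x. ?S * (\<Sum>a\<in>F. indicator B x * (cmod (e a x))\<^sup>2) \<partial>lebesgue)"
    unfolding mass_on_def
  proof (rule integral_mono)
    show "integrable lebesgue (\<lambda>x. indicator B x * (cmod (\<Sum>a\<in>F. c a * e a x))\<^sup>2)"
      by (intro integrable_mass_on L2_sum L2_scale e B)
    show "integrable lebesgue (\<lambda>x. ?S * (\<Sum>a\<in>F. indicator B x * (cmod (e a x))\<^sup>2))"
      by (intro integrable_mult_right Bochner_Integration.integrable_sum i)
    show "indicator B x * (cmod (\<Sum>a\<in>F. c a * e a x))\<^sup>2 \<le> ?S * (\<Sum>a\<in>F. indicator B x * (cmod (e a x))\<^sup>2)" for x
      using pt[of x] by (simp split: split_indicator)
  qed
  also have "\<dots> = ?S * (\<Sum>a\<in>F. mass_on B (e a))"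
    unfolding mass_on_def using i by (simp add: Bochner_Integration.integral_sum)
  finally show ?thesis .
qed

section \<open>Coarse and fine parts of a linear combination\<close>

lemma lin_comb_add_scaled:
  assumes "finite (supp_on A c)" "finite (supp_on A d)"
  shows "lin_comb e A (\<lambda>a. c a + z * d a) x = lin_comb e A c x + z * lin_comb e A d x"
    and "finite (supp_on A (\<lambda>a. c a + z * d a))"
proof -
  let ?F = "supp_on A c \<union> supp_on A d"
  have sub: "supp_on A (\<lambda>a. c a + z * d a) \<subseteq> ?F"
    by (auto simp: supp_on_def)
  with assms show "finite (supp_on A (\<lambda>a. c a + z * d a))" by (meson finite_UnI finite_subset)
  have F: "finite ?F" "?F \<subseteq> A" using assms supp_on_subset[of A c] supp_on_subset[of A d] by auto
  show "lin_comb e A (\<lambda>a. c a + z * d a) x = lin_comb e A c x + z * lin_comb e A d x"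
    using lin_comb_eq_sum[OF F(1) sub F(2), of e x] lin_comb_eq_sum[OF F(1) _ F(2), of c e x]
      lin_comb_eq_sum[OF F(1) _ F(2), of d e x]
    by (simp add: algebra_simps sum.distrib sum_distrib_left)
qed

text \<open>Dropping terms from a combination can increase the norm by at most the factor \<open>\<surd>(C\<^sub>4 / C\<^sub>3)\<close>: the
squared coefficients of the full sum are controlled by the lower bound, and those of the partial
sum control its norm by the upper bound.\<close>

lemma riesz_subfamily_bound:
  assumes low: "riesz_lower C3 e A" and up: "riesz_upper C4 e A" and "0 < C3" "0 < C4"
    and c: "finite (supp_on A c)" and d: "\<And>a. a \<in> A \<Longrightarrow> d a \<noteq> 0 \<Longrightarrow> d a = c a"
  shows "finite (supp_on A d)"
    and "L2norm (lin_comb e A d) \<le> sqrt (C4 / C3) * L2norm (lin_comb e A c)"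
proof -
  have sub: "supp_on A d \<subseteq> supp_on A c"
    using d by (auto simp: supp_on_def)
  then show fin: "finite (supp_on A d)" using c finite_subset by blast
  have "(\<Sum>a\<in>supp_on A d. (cmod (d a))\<^sup>2) = (\<Sum>a\<in>supp_on A d. (cmod (c a))\<^sup>2)"
    using d by (intro sum.cong) (auto simp: supp_on_def)
  also have "\<dots> \<le> (\<Sum>a\<in>supp_on A c. (cmod (c a))\<^sup>2)"
    using c sub by (intro sum_mono2) auto
  also have "\<dots> \<le> (L2norm (lin_comb e A c))\<^sup>2 / C3"
    using low c \<open>0 < C3\<close> by (simp add: riesz_lower_def field_simps)
  finally have "C4 * (\<Sum>a\<in>supp_on A d. (cmod (d a))\<^sup>2) \<le> C4 * ((L2norm (lin_comb e A c))\<^sup>2 / C3)"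
    using \<open>0 < C4\<close> by (intro mult_left_mono) auto
  moreover have "(L2norm (lin_comb e A d))\<^sup>2 \<le> C4 * (\<Sum>a\<in>supp_on A d. (cmod (d a))\<^sup>2)"
    using up fin by (simp add: riesz_upper_def)
  ultimately have "(L2norm (lin_comb e A d))\<^sup>2 \<le> (sqrt (C4 / C3) * L2norm (lin_comb e A c))\<^sup>2"
    using assms(3,4) by (simp add: power_mult_distrib)
  then show "L2norm (lin_comb e A d) \<le> sqrt (C4 / C3) * L2norm (lin_comb e A c)"
    by (rule power2_le_imp_le) (use assms(3,4) in simp)
qed

lemma supp_on_Inr:
  fixes c :: "int \<times> 'a \<times> (real^'c) \<Rightarrow> complex" and I :: "'b set"
  assumes "\<And>j l k. (j, l, k) \<in> hom_index L \<Longrightarrow> c (j, l, k) \<noteq> 0 \<Longrightarrow> J \<le> j"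
  shows "supp_on (nonhom_index J I L) (case_sum (\<lambda>_. 0) c) = Inr ` supp_on (hom_index L) c"
proof (rule set_eqI)
  fix a :: "('b \<times> (real^'c)) + int \<times> 'a \<times> (real^'c)"
  show "a \<in> supp_on (nonhom_index J I L) (case_sum (\<lambda>_. 0) c) \<longleftrightarrow> a \<in> Inr ` supp_on (hom_index L) c"
  proof (cases a)
    case (Inr b)
    obtain j l k where "b = (j, l, k)" by (cases b)
    then show ?thesis
      using assms[of j l k] by (auto simp: Inr supp_on_def nonhom_index_def hom_index_def)
  qed (auto simp: supp_on_def)
qed

lemma hom_as_nonhom:
  assumes "\<And>j l k. (j, l, k) \<in> hom_index L \<Longrightarrow> c (j, l, k) \<noteq> 0 \<Longrightarrow> J \<le> j"
  shows "lin_comb (nonhom_system M J \<phi> \<psi>) (nonhom_index J I L) (case_sum (\<lambda>_. 0) c)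
          = lin_comb (hom_system M \<psi>) (hom_index L) c"
    and "(\<Sum>a\<in>supp_on (nonhom_index J I L) (case_sum (\<lambda>_. 0) c). (cmod (case_sum (\<lambda>_. 0) c a))\<^sup>2)
          = (\<Sum>a\<in>supp_on (hom_index L) c. (cmod (c a))\<^sup>2)"
    and "finite (supp_on (nonhom_index J I L) (case_sum (\<lambda>_. 0) c)) \<longleftrightarrow> finite (supp_on (hom_index L) c)"
proof -
  have s: "supp_on (nonhom_index J I L) (case_sum (\<lambda>_. 0) c) = Inr ` supp_on (hom_index L) c"
    by (rule supp_on_Inr[OF assms])
  show "lin_comb (nonhom_system M J \<phi> \<psi>) (nonhom_index J I L) (case_sum (\<lambda>_. 0) c)
          = lin_comb (hom_system M \<psi>) (hom_index L) c"
    unfolding lin_comb_def s nonhom_system_def by (simp add: sum.reindex)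
  show "(\<Sum>a\<in>supp_on (nonhom_index J I L) (case_sum (\<lambda>_. 0) c). (cmod (case_sum (\<lambda>_. 0) c a))\<^sup>2)
          = (\<Sum>a\<in>supp_on (hom_index L) c. (cmod (c a))\<^sup>2)"
    unfolding s by (simp add: sum.reindex)
  show "finite (supp_on (nonhom_index J I L) (case_sum (\<lambda>_. 0) c)) \<longleftrightarrow> finite (supp_on (hom_index L) c)"
    unfolding s by (simp add: finite_image_iff)
qed

lemma coarsest_scale:
  assumes "finite (supp_on (hom_index L) c)"
  obtains J where "\<And>j l k. (j, l, k) \<in> hom_index L \<Longrightarrow> c (j, l, k) \<noteq> 0 \<Longrightarrow> J \<le> j"
proof -
  have "bdd_below (fst ` supp_on (hom_index L) c)"
    using assms by (intro bdd_below_finite) simp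
  then obtain J where J: "\<forall>j \<in> fst ` supp_on (hom_index L) c. J \<le> j"
    unfolding bdd_below_def by (elim exE)
  show ?thesis
  proof (rule that)
    fix j l k assume "(j, l, k) \<in> hom_index L" "c (j, l, k) \<noteq> 0"
    then have "(j, l, k) \<in> supp_on (hom_index L) c" by (simp add: supp_on_def)
    from bspec[OF J imageI[OF this]] show "J \<le> j" by simp
  qed
qed

lemma hom_riesz_lower:
  fixes M :: "real^'d^'d" and \<psi> :: "'l \<Rightarrow> real^'d \<Rightarrow> complex" and \<phi> :: "'i \<Rightarrow> real^'d \<Rightarrow> complex"
  assumes "\<And>J. riesz_lower C (nonhom_system M J \<phi> \<psi>) (nonhom_index J I L)"
  shows "riesz_lower C (hom_system M \<psi>) (hom_index L)"
  unfolding riesz_lower_def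
proof (intro allI impI)
  fix c :: "int \<times> 'l \<times> (real^'d) \<Rightarrow> complex"
  assume fin: "finite (supp_on (hom_index L) c)"
  obtain J where J: "\<And>j l k. (j, l, k) \<in> hom_index L \<Longrightarrow> c (j, l, k) \<noteq> 0 \<Longrightarrow> J \<le> j"
    using coarsest_scale[OF fin] by blast
  note tr = hom_as_nonhom[OF J, where I = I and L = L and c = c]
  show "C * (\<Sum>a\<in>supp_on (hom_index L) c. (cmod (c a))\<^sup>2) \<le> (L2norm (lin_comb (hom_system M \<psi>) (hom_index L) c))\<^sup>2"
    using assms[of J, unfolded riesz_lower_def, rule_format, of "case_sum (\<lambda>_. 0) c"] fin tr by simp
qed

lemma hom_riesz_upper:
  fixes M :: "real^'d^'d" and \<psi> :: "'l \<Rightarrow> real^'d \<Rightarrow> complex" and \<phi> :: "'i \<Rightarrow> real^'d \<Rightarrow> complex"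
  assumes "\<And>J. riesz_upper C (nonhom_system M J \<phi> \<psi>) (nonhom_index J I L)"
  shows "riesz_upper C (hom_system M \<psi>) (hom_index L)"
  unfolding riesz_upper_def
proof (intro allI impI)
  fix c :: "int \<times> 'l \<times> (real^'d) \<Rightarrow> complex"
  assume fin: "finite (supp_on (hom_index L) c)"
  obtain J where J: "\<And>j l k. (j, l, k) \<in> hom_index L \<Longrightarrow> c (j, l, k) \<noteq> 0 \<Longrightarrow> J \<le> j"
    using coarsest_scale[OF fin] by blast
  note tr = hom_as_nonhom[OF J, where I = I and L = L and c = c]
  show "(L2norm (lin_comb (hom_system M \<psi>) (hom_index L) c))\<^sup>2 \<le> C * (\<Sum>a\<in>supp_on (hom_index L) c. (cmod (c a))\<^sup>2)"
    using assms[of J, unfolded riesz_upper_def, rule_format, of "case_sum (\<lambda>_. 0) c"] fin tr by simp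
qed

text \<open>For each generator the different translates \<open>k\<close> use disjoint balls about lattice points, so all of
them together see no more than its mass near the lattice. The bound is therefore independent of
the number of translates in \<open>F\<close>.\<close>

lemma coarse_part_mass_le:
  fixes M :: "real^'d^'d" and \<phi> :: "'i \<Rightarrow> real^'d \<Rightarrow> complex"
  assumes inv: "invertible M" and \<phi>: "\<forall>i\<in>I. \<phi> i \<in> L2" and B: "B \<in> sets lebesgue"
    and sub: "\<And>x. x \<in> B \<Longrightarrow> mat_powi M J *v x \<in> ball 0 r" and r: "r \<le> 1/2"
    and small: "\<And>G. finite G \<Longrightarrow> G \<subseteq> I \<Longrightarrow> (\<Sum>i\<in>G. mass_on (lattice_nbhd r) (\<phi> i)) \<le> \<eta>"
    and F: "finite F" "F \<subseteq> I \<times> int_points"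
  shows "mass_on B (\<lambda>x. \<Sum>(i, k)\<in>F. v (i, k) * dilate (mat_powi M J) k (\<phi> i) x)
          \<le> (\<Sum>a\<in>F. (cmod (v a))\<^sup>2) * \<eta>"
proof -
  let ?e = "\<lambda>(i, k). dilate (mat_powi M J) k (\<phi> i)"
  note invJ = invertible_mat_powi[OF inv, of J]
  have e: "?e a \<in> L2" if "a \<in> F" for a
    using that F(2) \<phi> by (auto intro!: L2_dilate[OF invJ])
  have "mass_on B (\<lambda>x. \<Sum>a\<in>F. v a * ?e a x) \<le> (\<Sum>a\<in>F. (cmod (v a))\<^sup>2) * (\<Sum>a\<in>F. mass_on B (?e a))"
    by (rule mass_on_sum_le[OF e F(1) B])
  also have "\<dots> \<le> (\<Sum>a\<in>F. (cmod (v a))\<^sup>2) * \<eta>"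
  proof (intro mult_left_mono sum_nonneg)
    have "(\<Sum>a\<in>F. mass_on B (?e a)) \<le> (\<Sum>(i, k)\<in>F. mass_on (ball (- k) r) (\<phi> i))"
    proof (rule sum_mono)
      fix a assume "a \<in> F"
      then show "mass_on B (?e a) \<le> (case a of (i, k) \<Rightarrow> mass_on (ball (- k) r) (\<phi> i))"
        using F(2) \<phi> by (auto intro!: mass_on_dilate_le[OF invJ _ B sub])
    qed
    also have "\<dots> = (\<Sum>i\<in>fst ` F. \<Sum>k\<in>{k. (i, k) \<in> F}. mass_on (ball (- k) r) (\<phi> i))"
    proof -
      have "finite {k. (i, k) \<in> F}" for i
        using finite_subset[of "{k. (i, k) \<in> F}" "snd ` F"] F(1) by force
      moreover have "F = Sigma (fst ` F) (\<lambda>i. {k. (i, k) \<in> F})" by force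
      ultimately show ?thesis
        using F(1) by (subst sum.Sigma) auto
    qed
    also have "\<dots> \<le> (\<Sum>i\<in>fst ` F. mass_on (lattice_nbhd r) (\<phi> i))"
    proof (rule sum_mono)
      fix i assume "i \<in> fst ` F"
      then have "\<phi> i \<in> L2" "finite {k. (i, k) \<in> F}" "{k. (i, k) \<in> F} \<subseteq> int_points"
        using F \<phi> finite_subset[of "{k. (i, k) \<in> F}" "snd ` F"] by force+
      then show "(\<Sum>k\<in>{k. (i, k) \<in> F}. mass_on (ball (- k) r) (\<phi> i)) \<le> mass_on (lattice_nbhd r) (\<phi> i)"
        by (rule sum_mass_on_balls_le[OF _ _ _ r])
    qed
    also have "\<dots> \<le> \<eta>"
      using F by (intro small) auto
    finally show "(\<Sum>a\<in>F. mass_on B (?e a)) \<le> \<eta>" .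
  qed simp
  finally show ?thesis by (simp add: split_def)
qed

lemma mass_outside_large_ball:
  fixes f :: "real^'d \<Rightarrow> complex"
  assumes "f \<in> L2" "0 < \<eta>"
  obtains R where "0 < R" "mass_on (- ball 0 R) f < \<eta>"
proof -
  have "(\<lambda>n. mass_on (- ball 0 (real n + 1)) f) \<longlonglongrightarrow> 0"
  proof (rule mass_on_tendsto_0[OF assms(1)])
    have "\<forall>\<^sub>F n in sequentially. x \<notin> - ball 0 (real n + 1)" for x :: "real^'d"
    proof -
      obtain N :: nat where "norm x < real N" using reals_Archimedean2 by blast
      then have "\<forall>n\<ge>N. x \<notin> - ball 0 (real n + 1)" by auto
      then show ?thesis unfolding eventually_sequentially by blast
    qed
    then show "AE x in lebesgue. \<forall>\<^sub>F n in sequentially. (x :: real^'d) \<notin> - ball 0 (real n + 1)"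
      by simp
  qed auto
  then have "\<forall>\<^sub>F n in sequentially. mass_on (- ball 0 (real n + 1)) f < \<eta>"
    using assms(2) by (rule order_tendstoD(2))
  then obtain n where "mass_on (- ball 0 (real n + 1)) f < \<eta>"
    unfolding eventually_sequentially by blast
  then show ?thesis by (intro that[of "real n + 1"]) auto
qed

lemma coarse_scale_contracts:
  fixes M :: "real^'d^'d"
  assumes "invertible M" "expansive M" "0 < r" "0 < R"
  obtains J where "\<And>x. x \<in> ball 0 R \<Longrightarrow> mat_powi M J *v x \<in> ball 0 r"
proof -
  obtain n where n: "\<And>x. norm (mat_pow (matrix_inv M) n *v x) \<le> r / R * norm x"
    using expansive_inverse_powers_uniform[OF assms(1,2), of "r / R"] assms(3,4) by auto
  have J: "mat_powi M (- int n) = mat_pow (matrix_inv M) n"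
    by (simp add: mat_powi_def)
  have "mat_powi M (- int n) *v x \<in> ball 0 r" if "x \<in> ball 0 R" for x
  proof -
    have "r / R * norm x < r"
      using that assms(3,4) by (simp add: field_simps)
    with n[of x] show ?thesis by (simp add: J)
  qed
  then show ?thesis by (rule that)
qed

section \<open>Completeness of the homogeneous system\<close>

text \<open>A finite combination whose squared error is within \<open>\<delta>\<^sup>2\<close> of the infimum replaces the orthogonal
projection onto the closed span.\<close>

lemma near_best_approximation:
  fixes f :: "real^'d \<Rightarrow> complex"
  assumes e: "\<And>a. a \<in> A \<Longrightarrow> e a \<in> L2" and f: "f \<in> L2" and "0 < \<delta>"
  obtains c where "finite (supp_on A c)"
    "\<And>d. finite (supp_on A d) \<Longrightarrow>
      \<bar>L2inner (\<lambda>x. f x - lin_comb e A c x) (lin_comb e A d)\<bar> \<le> \<delta> * L2norm (lin_comb e A d)"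
proof -
  \<comment> \<open>The squared errors of all finite combinations; the infimum need not be attained.\<close>
  define S where "S = (\<lambda>c. (L2norm (\<lambda>x. f x - lin_comb e A c x))\<^sup>2) ` {c. finite (supp_on A c)}"
  have "(\<lambda>_. 0) \<in> {c. finite (supp_on A c)}" by (simp add: supp_on_def)
  then have "S \<noteq> {}" unfolding S_def by blast
  moreover have bdd: "bdd_below S" unfolding S_def by (rule bdd_belowI[of _ 0]) auto
  moreover have "Inf S < Inf S + \<delta>\<^sup>2" using \<open>0 < \<delta>\<close> by simp
  ultimately obtain s where "s \<in> S" "s < Inf S + \<delta>\<^sup>2"
    using cInf_less_iff by blast
  then obtain c where c: "finite (supp_on A c)"
    and less: "(L2norm (\<lambda>x. f x - lin_comb e A c x))\<^sup>2 < Inf S + \<delta>\<^sup>2"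
    unfolding S_def by blast
  let ?g = "\<lambda>x. f x - lin_comb e A c x"
  have g: "?g \<in> L2" by (intro L2_diff f L2_lin_comb e)
  show ?thesis
  proof (rule that[OF c])
    fix d assume d: "finite (supp_on A d)"
    let ?w = "lin_comb e A d"
    have w: "?w \<in> L2" by (intro L2_lin_comb e)
    have "Inf S \<le> (L2norm (\<lambda>x. ?g x - t *\<^sub>R ?w x))\<^sup>2" for t
    proof (rule cInf_lower[OF _ bdd])
      let ?c = "\<lambda>a. c a + complex_of_real t * d a"
      have eq: "(\<lambda>x. ?g x - t *\<^sub>R ?w x) = (\<lambda>x. f x - lin_comb e A ?c x)"
        by (simp add: lin_comb_add_scaled(1)[OF c d] scaleR_conv_of_real diff_diff_eq)
      show "(L2norm (\<lambda>x. ?g x - t *\<^sub>R ?w x))\<^sup>2 \<in> S"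
        unfolding S_def eq using lin_comb_add_scaled(2)[OF c d] by (intro imageI) simp
    qed
    then have "(L2inner ?g ?w)\<^sup>2 \<le> ((L2norm ?g)\<^sup>2 - Inf S) * (L2norm ?w)\<^sup>2"
      by (rule near_minimizer_almost_orthogonal[OF g w])
    also have "\<dots> \<le> \<delta>\<^sup>2 * (L2norm ?w)\<^sup>2"
      using less by (intro mult_right_mono) auto
    finally have "\<bar>L2inner ?g ?w\<bar>\<^sup>2 \<le> (\<delta> * L2norm ?w)\<^sup>2"
      by (simp add: power_mult_distrib)
    then show "\<bar>L2inner ?g ?w\<bar> \<le> \<delta> * L2norm ?w"
      by (rule power2_le_imp_le) (use \<open>0 < \<delta>\<close> in simp)
  qed
qed

text \<open>Separates the terms with \<open>\<phi>\<close> from those with \<open>\<psi>\<close>. The latter form a combination of the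
homogeneous system; both parts and the coefficients of the former are controlled by the norm of
the whole.\<close>

lemma split_nonhom_lin_comb:
  fixes M :: "real^'d^'d" and \<phi> :: "'i \<Rightarrow> real^'d \<Rightarrow> complex" and \<psi> :: "'l \<Rightarrow> real^'d \<Rightarrow> complex"
    and c :: "('i \<times> (real^'d)) + (int \<times> 'l \<times> (real^'d)) \<Rightarrow> complex"
  assumes low: "riesz_lower C3 (nonhom_system M J \<phi> \<psi>) (nonhom_index J I L)"
    and up: "riesz_upper C4 (nonhom_system M J \<phi> \<psi>) (nonhom_index J I L)"
    and "0 < C3" "0 < C4" and c: "finite (supp_on (nonhom_index J I L) c)"
  defines "p \<equiv> lin_comb (nonhom_system M J \<phi> \<psi>) (nonhom_index J I L) c"
  obtains F u d where "finite F" "F \<subseteq> I \<times> int_points"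
    "u = (\<lambda>x. \<Sum>(i, k)\<in>F. c (Inl (i, k)) * dilate (mat_powi M J) k (\<phi> i) x)"
    "C3 * (\<Sum>a\<in>F. (cmod (c (Inl a)))\<^sup>2) \<le> (L2norm p)\<^sup>2"
    "L2norm u \<le> sqrt (C4 / C3) * L2norm p"
    "finite (supp_on (hom_index L) d)"
    "L2norm (lin_comb (hom_system M \<psi>) (hom_index L) d) \<le> sqrt (C4 / C3) * L2norm p"
    "\<And>x. p x = u x + lin_comb (hom_system M \<psi>) (hom_index L) d x"
proof -
  let ?e = "nonhom_system M J \<phi> \<psi>" and ?A = "nonhom_index J I L :: (('i \<times> (real^'d)) + (int \<times> 'l \<times> (real^'d))) set"
  define F where "F = {a. Inl a \<in> supp_on ?A c}"
  define u where "u = (\<lambda>x. \<Sum>(i, k)\<in>F. c (Inl (i, k)) * dilate (mat_powi M J) k (\<phi> i) x)"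
  define cl :: "('i \<times> (real^'d)) + (int \<times> 'l \<times> (real^'d)) \<Rightarrow> complex" where "cl = case_sum (c \<circ> Inl) (\<lambda>_. 0)"
  define d :: "int \<times> 'l \<times> (real^'d) \<Rightarrow> complex" where "d = (\<lambda>b. if J \<le> fst b then c (Inr b) else 0)"
  define cr :: "('i \<times> (real^'d)) + (int \<times> 'l \<times> (real^'d)) \<Rightarrow> complex" where "cr = case_sum (\<lambda>_. 0) d"
  have supp_cl: "supp_on ?A cl = Inl ` F"
  proof (rule set_eqI)
    show "a \<in> supp_on ?A cl \<longleftrightarrow> a \<in> Inl ` F" for a
      by (cases a) (auto simp: supp_on_def F_def cl_def)
  qed
  have cl: "cl a \<noteq> 0 \<Longrightarrow> cl a = c a" and cr: "cr a \<noteq> 0 \<Longrightarrow> cr a = c a" for a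
    by (auto simp: cl_def cr_def d_def split: sum.splits if_splits)
  have sum: "c a = cl a + 1 * cr a" if "a \<in> ?A" for a
    using that by (cases a) (auto simp: cl_def cr_def d_def nonhom_index_def)
  note bcl = riesz_subfamily_bound[OF low up assms(3,4) c cl]
  note bcr = riesz_subfamily_bound[OF low up assms(3,4) c cr]
  have "Inl ` F \<subseteq> supp_on ?A c" by (auto simp: F_def)
  then have F: "finite F" using c finite_subset finite_imageD inj_Inl by (metis inj_on_subset subset_UNIV)
  have FI: "F \<subseteq> I \<times> int_points" by (auto simp: F_def supp_on_def nonhom_index_def)
  have lcl: "lin_comb ?e ?A cl = u"
    unfolding lin_comb_def supp_cl u_def
    by (auto simp: sum.reindex fun_eq_iff nonhom_system_def cl_def intro!: sum.cong)
  have J: "J \<le> j" if "(j, l, k) \<in> hom_index L" "d (j, l, k) \<noteq> 0" for j l k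
    using that by (auto simp: d_def split: if_splits)
  have lcr: "lin_comb ?e ?A cr = lin_comb (hom_system M \<psi>) (hom_index L) d"
    unfolding cr_def by (rule hom_as_nonhom(1)[OF J])
  have fd: "finite (supp_on (hom_index L) d)"
    by (rule iffD1[OF hom_as_nonhom(3)[OF J] bcr(1)[unfolded cr_def]])
  have "p = lin_comb ?e ?A (\<lambda>a. cl a + 1 * cr a)"
    using sum by (auto simp: p_def lin_comb_def supp_on_def fun_eq_iff intro!: sum.cong)
  then have p: "p x = u x + lin_comb (hom_system M \<psi>) (hom_index L) d x" for x
    using lin_comb_add_scaled(1)[OF bcl(1) bcr(1), of ?e 1 x] by (simp add: lcl lcr)
  have "(\<Sum>a\<in>F. (cmod (c (Inl a)))\<^sup>2) = (\<Sum>a\<in>Inl ` F. (cmod (c a))\<^sup>2)"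
    by (simp add: sum.reindex)
  also have "\<dots> \<le> (\<Sum>a\<in>supp_on ?A c. (cmod (c a))\<^sup>2)"
    using c by (intro sum_mono2) (auto simp: F_def)
  finally have "C3 * (\<Sum>a\<in>F. (cmod (c (Inl a)))\<^sup>2) \<le> C3 * (\<Sum>a\<in>supp_on ?A c. (cmod (c a))\<^sup>2)"
    using \<open>0 < C3\<close> by simp
  also have "\<dots> \<le> (L2norm p)\<^sup>2"
    using low c by (simp add: riesz_lower_def p_def)
  finally show ?thesis
    using that[OF F FI u_def _ _ fd _ p] bcl(2) bcr(2) lcl lcr by (simp add: p_def)
qed

text \<open>If the almost orthogonal error \<open>g\<close> of an approximation had norm \<open>N \<ge> \<epsilon>\<close>, then, with
\<open>p = u + w\<close> close to \<open>g\<close>, with \<open>h\<close> the part of \<open>g\<close> outside a large ball and \<open>v\<close> the part of \<open>u\<close>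
inside it,
\<open>N\<^sup>2 = \<langle>g, g - p\<rangle> + \<langle>g, w\<rangle> + \<langle>h, u\<rangle> + \<langle>g, v\<rangle>\<close>. All four terms are small: by the choice of \<open>p\<close>, by
almost orthogonality, by the choice of the ball, and by the choice of a coarse scale \<open>J\<close>,
respectively. The tolerances are chosen so that the terms sum to at most \<open>5 N\<^sup>2 / 8\<close>.\<close>

lemma hom_dense_span:
  fixes M :: "real^'d^'d"
  assumes inv: "invertible M" and exp: "expansive M"
    and \<phi>: "\<forall>i\<in>I. \<phi> i \<in> L2" and \<psi>: "\<forall>l\<in>L. \<psi> l \<in> L2"
    and sm: "(\<lambda>i. (L2norm (\<phi> i))\<^sup>2) summable_on I"
    and basis: "\<And>J. riesz_basis_with C3 C4 (nonhom_system M J \<phi> \<psi>) (nonhom_index J I L)"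
  shows "dense_span (hom_system M \<psi>) (hom_index L)"
  unfolding dense_span_def
proof (intro ballI allI impI)
  fix f :: "real^'d \<Rightarrow> complex" and \<epsilon> :: real
  assume f: "f \<in> L2" and \<epsilon>: "0 < \<epsilon>"
  let ?e = "hom_system M \<psi>" and ?A = "hom_index L"
  have C: "0 < C3" "0 < C4" using basis by (auto simp: riesz_basis_with_def)
  define K where "K = sqrt (C4 / C3)"
  have K: "0 < K" using C by (simp add: K_def)
  have e: "?e a \<in> L2" if "a \<in> ?A" for a
    using that \<psi> by (auto simp: hom_index_def hom_system_def intro!: L2_dilate invertible_mat_powi[OF inv])
  obtain c where c: "finite (supp_on ?A c)" and orth: "\<And>d. finite (supp_on ?A d) \<Longrightarrow>
      \<bar>L2inner (\<lambda>x. f x - lin_comb ?e ?A c x) (lin_comb ?e ?A d)\<bar> \<le> \<epsilon> / (16 * K) * L2norm (lin_comb ?e ?A d)"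
    by (rule near_best_approximation[where e = ?e and A = ?A, OF e f, of "\<epsilon> / (16 * K)"])
      (use \<epsilon> K in auto)
  define g where "g = (\<lambda>x. f x - lin_comb ?e ?A c x)"
  have g: "g \<in> L2" unfolding g_def by (intro L2_diff f L2_lin_comb e)
  define N where "N = L2norm g"
  have "N < \<epsilon>"
  proof (rule ccontr)
    assume "\<not> N < \<epsilon>"
    then have N: "\<epsilon> \<le> N" "0 < N" using \<epsilon> by auto
    \<comment> \<open>The ball and the radius about the lattice are fixed first; then the scale \<open>J\<close>, which has to
      contract the ball into that radius; and only then \<open>p\<close>, whose number of terms is not
      controlled.\<close>
    obtain R where R: "0 < R" "mass_on (- ball 0 R) g < (N / (16 * K))\<^sup>2"
      using mass_outside_large_ball[OF g, of "(N / (16 * K))\<^sup>2"] N K by auto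
    obtain r where r: "0 < r" "r \<le> 1/2"
      and small: "\<And>G. finite G \<Longrightarrow> G \<subseteq> I \<Longrightarrow> (\<Sum>i\<in>G. mass_on (lattice_nbhd r) (\<phi> i)) \<le> C3 / 256"
      using uniformly_small_mass_near_lattice[OF \<phi> sm, of "C3 / 256"] C by auto
    obtain J where J: "\<And>x. x \<in> ball 0 R \<Longrightarrow> mat_powi M J *v x \<in> ball 0 r"
      using coarse_scale_contracts[OF inv exp r(1) R(1)] by blast
    let ?ne = "nonhom_system M J \<phi> \<psi>" and ?nA = "nonhom_index J I L"
    have low: "riesz_lower C3 ?ne ?nA" and up: "riesz_upper C4 ?ne ?nA" and "dense_span ?ne ?nA"
      using basis[of J] by (auto simp: riesz_basis_with_def)
    moreover have "0 < N / 4" using N by simp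
    ultimately obtain cp where cp: "finite (supp_on ?nA cp)"
      and close: "L2norm (\<lambda>x. g x - lin_comb ?ne ?nA cp x) < N / 4"
      using g unfolding dense_span_def by blast
    define p where "p = lin_comb ?ne ?nA cp"
    obtain F u d where F: "finite F" "F \<subseteq> I \<times> int_points"
      and u_def: "u = (\<lambda>x. \<Sum>(i, k)\<in>F. cp (Inl (i, k)) * dilate (mat_powi M J) k (\<phi> i) x)"
      and coeff: "C3 * (\<Sum>a\<in>F. (cmod (cp (Inl a)))\<^sup>2) \<le> (L2norm p)\<^sup>2"
      and un: "L2norm u \<le> K * L2norm p"
      and d: "finite (supp_on ?A d)"
      and wn: "L2norm (lin_comb ?e ?A d) \<le> K * L2norm p"
      and p_eq: "\<And>x. p x = u x + lin_comb ?e ?A d x"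
      by (rule split_nonhom_lin_comb[OF low up C cp, folded K_def p_def]) (rule that; assumption)
    define w where "w = lin_comb ?e ?A d"
    have w: "w \<in> L2" unfolding w_def by (intro L2_lin_comb e)
    have p: "p \<in> L2" unfolding p_def by (intro L2_lin_comb L2_nonhom_system[OF inv \<phi> \<psi>])
    have u: "u \<in> L2" using L2_diff[OF p w] by (simp add: p_eq w_def)
    have gp: "(\<lambda>x. g x - p x) \<in> L2" by (rule L2_diff[OF g p])
    have pn: "L2norm p \<le> 2 * N"
    proof -
      have "L2norm (\<lambda>x. g x - (g x - p x)) \<le> L2norm g + L2norm (\<lambda>x. g x - p x)"
        by (rule L2norm_triangle_diff[OF g gp])
      then show ?thesis using close N by (simp add: N_def p_def)
    qed
    have I1: "L2inner g (\<lambda>x. g x - p x) \<le> N * (N / 4)"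
    proof -
      have "L2inner g (\<lambda>x. g x - p x) \<le> N * L2norm (\<lambda>x. g x - p x)"
        using L2_Cauchy_Schwarz[OF g gp] by (simp add: N_def)
      also have "\<dots> \<le> N * (N / 4)"
        using close N by (intro mult_left_mono) (auto simp: p_def)
      finally show ?thesis .
    qed
    have I2: "L2inner g w \<le> N * (N / 8)"
    proof -
      have "L2inner g w \<le> \<epsilon> / (16 * K) * L2norm w"
        using orth[OF d] by (simp add: g_def w_def)
      also have "\<dots> \<le> N / (16 * K) * (K * (2 * N))"
      proof (rule mult_mono)
        show "L2norm w \<le> K * (2 * N)"
          unfolding w_def by (rule order_trans[OF wn mult_left_mono[OF pn]]) (use K in simp)
      qed (use N K in \<open>auto simp: divide_right_mono\<close>)
      finally show ?thesis using K by simp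
    qed
    let ?B = "ball 0 R :: (real^'d) set"
    define h where "h = (\<lambda>x. indicator (- ?B) x *\<^sub>R g x)"
    define v where "v = (\<lambda>x. indicator ?B x *\<^sub>R u x)"
    have h: "h \<in> L2" and v: "v \<in> L2" unfolding h_def v_def by (auto intro!: L2_restrict g u)
    have I3: "L2inner h u \<le> N * (N / 8)"
    proof -
      have "(L2norm h)\<^sup>2 \<le> (N / (16 * K))\<^sup>2"
        using R(2) unfolding h_def L2norm_restrict by simp
      then have "L2norm h \<le> N / (16 * K)"
        by (rule power2_le_imp_le) (use N K in simp)
      moreover have "L2norm u \<le> K * (2 * N)"
        by (rule order_trans[OF un mult_left_mono[OF pn]]) (use K in simp)
      ultimately have "L2norm h * L2norm u \<le> N / (16 * K) * (K * (2 * N))"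
        using N K by (intro mult_mono) auto
      then show ?thesis using L2_Cauchy_Schwarz[OF h u] K by simp
    qed
    have I4: "L2inner g v \<le> N * (N / 8)"
    proof -
      have "(L2norm v)\<^sup>2 \<le> (\<Sum>a\<in>F. (cmod (cp (Inl a)))\<^sup>2) * (C3 / 256)"
        unfolding v_def L2norm_restrict u_def
        by (rule coarse_part_mass_le[OF inv \<phi> _ J r(2) small F, where v = "cp \<circ> Inl", unfolded o_def]) auto
      also have "\<dots> \<le> (L2norm p)\<^sup>2 / 256" using coeff by (simp add: mult.commute)
      also have "\<dots> \<le> (2 * N)\<^sup>2 / 256" using pn by (intro divide_right_mono power_mono) auto
      also have "\<dots> = (N / 8)\<^sup>2" by (simp add: power_divide power_mult_distrib)
      finally have "L2norm v \<le> N / 8" by (rule power2_le_imp_le) (use N in simp)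
      then have "N * L2norm v \<le> N * (N / 8)" using N by (intro mult_left_mono) auto
      then show ?thesis using L2_Cauchy_Schwarz[OF g v] by (simp add: N_def)
    qed
    have "N\<^sup>2 = L2inner g g" by (simp add: N_def L2inner_self)
    also have "\<dots> = L2inner g (\<lambda>x. (g x - p x) + p x)" by simp
    also have "\<dots> = L2inner g (\<lambda>x. g x - p x) + L2inner g p"
      by (rule L2inner_add_right[OF g gp p])
    also have "L2inner g p = L2inner g u + L2inner g w"
    proof -
      have "p = (\<lambda>x. u x + w x)" by (simp add: fun_eq_iff p_eq w_def)
      then show ?thesis using L2inner_add_right[OF g u w] by simp
    qed
    also have "L2inner g u = L2inner h u + L2inner g v"
    proof -
      have "g x \<bullet> u x = h x \<bullet> u x + g x \<bullet> v x" for x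
        by (simp add: h_def v_def split: split_indicator)
      then show ?thesis
        using integrable_L2inner[OF h u] integrable_L2inner[OF g v] by (simp add: L2inner_def)
    qed
    finally have "N\<^sup>2 \<le> N * (N / 4) + ((N * (N / 8) + N * (N / 8)) + N * (N / 8))"
      using I1 I2 I3 I4 by linarith
    then have "N\<^sup>2 \<le> N\<^sup>2 * (5/8)" by (simp add: power2_eq_square)
    with N show False by simp
  qed
  then show "\<exists>c. finite (supp_on ?A c) \<and> L2norm (\<lambda>x. f x - lin_comb ?e ?A c x) < \<epsilon>"
    using c by (auto simp: N_def g_def)
qed

theorem theorem6:
  fixes M :: "real^'d^'d"
    and \<phi> :: "'i \<Rightarrow> real^'d \<Rightarrow> complex" and I :: "'i set"
    and \<psi> :: "'l \<Rightarrow> real^'d \<Rightarrow> complex" and L :: "'l set"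
    and J :: int and C3 C4 :: real
  assumes "invertible M"
    and "\<forall>i\<in>I. \<phi> i \<in> L2" and "\<forall>l\<in>L. \<psi> l \<in> L2"
    and "riesz_basis_with C3 C4 (nonhom_system M J \<phi> \<psi>) (nonhom_index J I L)"
  shows "(\<forall>J'. riesz_basis_with C3 C4 (nonhom_system M J' \<phi> \<psi>) (nonhom_index J' I L)
            \<and> lower_riesz_bound (nonhom_system M J' \<phi> \<psi>) (nonhom_index J' I L)
              = lower_riesz_bound (nonhom_system M J \<phi> \<psi>) (nonhom_index J I L)
            \<and> upper_riesz_bound (nonhom_system M J' \<phi> \<psi>) (nonhom_index J' I L)
              = upper_riesz_bound (nonhom_system M J \<phi> \<psi>) (nonhom_index J I L))
       \<and> (expansive M \<and> (\<lambda>i. (L2norm (\<phi> i))\<^sup>2) summable_on I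
            \<longrightarrow> riesz_basis_with C3 C4 (hom_system M \<psi>) (hom_index L))"
proof -
  note shift = nonhom_riesz_shift[OF assms(1-3)]
  have L2: "nonhom_system M J' \<phi> \<psi> a \<in> L2" if "a \<in> nonhom_index J' I L" for J' a
    by (rule L2_nonhom_system[OF assms(1-3) that])
  have basis: "riesz_basis_with C3 C4 (nonhom_system M J' \<phi> \<psi>) (nonhom_index J' I L)" for J'
    using assms(4) L2[of _ J'] shift(1)[of C3 J J'] shift(2)[of C4 J J'] shift(3)[of J J']
    unfolding riesz_basis_with_def by blast
  have bounds: "lower_riesz_bound (nonhom_system M J' \<phi> \<psi>) (nonhom_index J' I L)
        = lower_riesz_bound (nonhom_system M J \<phi> \<psi>) (nonhom_index J I L)"
      "upper_riesz_bound (nonhom_system M J' \<phi> \<psi>) (nonhom_index J' I L)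
        = upper_riesz_bound (nonhom_system M J \<phi> \<psi>) (nonhom_index J I L)" for J'
    unfolding lower_riesz_bound_def upper_riesz_bound_def
    by (simp_all only: shift(1)[of _ J' J] shift(2)[of _ J' J])
  have "riesz_basis_with C3 C4 (hom_system M \<psi>) (hom_index L)"
    if "expansive M" "(\<lambda>i. (L2norm (\<phi> i))\<^sup>2) summable_on I"
    unfolding riesz_basis_with_def
  proof (intro conjI ballI)
    show "hom_system M \<psi> a \<in> L2" if "a \<in> hom_index L" for a
      using that assms(3)
      by (auto simp: hom_index_def hom_system_def intro!: L2_dilate invertible_mat_powi[OF assms(1)])
    show "dense_span (hom_system M \<psi>) (hom_index L)"
      by (rule hom_dense_span[OF assms(1) that(1) assms(2,3) that(2) basis])
    show "riesz_lower C3 (hom_system M \<psi>) (hom_index L)" "riesz_upper C4 (hom_system M \<psi>) (hom_index L)"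
      using basis by (auto simp: riesz_basis_with_def intro!: hom_riesz_lower hom_riesz_upper)
    show "0 < C3" "0 < C4" using assms(4) by (auto simp: riesz_basis_with_def)
  qed
  with basis bounds show ?thesis by blast
qed

end
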